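(* Let $\ell\geq1$ be an integer. Suppose that the chain $\Phi$ with (stochastic or sub-stochastic) transition kernel $P$ on $(X,\mathcal{B}(X))$ is $\psi$-irreducible. Then the following statements are equivalent. (1) There exists a set $A\in\mathcal{B}^{+}(X)$ such that $$\sup_{x\in A}\sum_{n=1}^{\infty}n^{\ell}P^{n}(x,A)<\infty.$$ (2) There exists a set $A\in\mathcal{B}^{+}(X)$ such that $$\sup_{x\in A}L(x,A)<1,\qquad \sup_{x\in A}\mathbb{E}_x\left[\tau_A^{\ell}1_{\{\tau_A<\infty\}}\right]<\infty.$$ (3) There exist a set $A\in\mathcal{B}^{+}(X)$, constants $d\in(0,\infty)$, $b\in(0,1)$, and nonnegative measurable functions $W_i$, $i=0,1,\dots,\ell$, with $W_i(x_0)<\infty$ for some $x_0\in X$, satisfying for $i=0,1,\dots,\ell$ $$\begin{cases} PW_i(x)\leq W_i(x)-(\ell-i)W_{i+1}(x), & x\in A^{c};\\ W_i(x)\geq1, & x\in A;\\ PW_0(x)\leq d, & x\in A;\\ PW_{\ell}(x)\leq b, & x\in A, \end{cases}$$ where $W_{\ell+1}=0$. (4) The chain $\Phi$ is $\ell$-transient.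
   Context: Setting: $\Phi=\{\Phi_n:n\in\mathbb{Z}_+\}$ is a discrete-time homogeneous Markov chain on a general state space $X$ with a countably generated $\sigma$-field $\mathcal{B}(X)$. $P^n(x,A)=\mathbb{P}_x\{\Phi_n\in A\}$ is its $n$-step transition kernel; $P$ may be stochastic or sub-stochastic (in the sub-stochastic case the chain may leave $X$, after which it never returns). $\mathbb{P}_x,\mathbb{E}_x$ refer to $\Phi_0=x$. For measurable $f\ge 0$, $P^nf(x)=\int_X f(y)P^n(x,dy)$. Irreducibility: $\Phi$ is $\psi$-irreducible, where $\psi$ is a maximal irreducibility measure: $\psi$ is a nontrivial $\sigma$-finite measure such that $\psi(A)>0$ implies that for every $x\in X$ there is $n\ge1$ with $P^n(x,A)>0$, and every other measure with this property is absolutely continuous with respect to $\psi$. $\mathcal{B}^{+}(X)=\{A\in\mathcal{B}(X):\psi(A)>0\}$. First return time: $\tau_A=\inf\{n\geq1:\Phi_n\in A\}$ ($\inf\emptyset=\infty$), and $L(x,A)=\mathbb{P}_x\{\tau_A<\infty\}$. Algebraic transience: for an integer $\ell\ge1$, a set $A\in\mathcal{B}^{+}(X)$ is uniformly $\ell$-transient if $\sup_{x\in A}\sum_{n=1}^{\infty}n^{\ell}P^{n}(x,A)<\infty$. The chain is $\ell$-transient if it is $\psi$-irreducible and there exist sets $D$ and $A_i$, $i=1,2,\dots$ with $X=D\cup\bigcup_{i=1}^\infty A_i$, $\psi(D)=0$, and each $A_i$ uniformly $\ell$-transient. Convention: the functions $W_i$ may take the value $+\infty$, and the inequality $PW_i(x)\le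 W_i(x)-(\ell-i)W_{i+1}(x)$ is understood as $PW_i(x)+(\ell-i)W_{i+1}(x)\le W_i(x)$ in $[0,\infty]$. *)

theory Defs
  imports "HOL-Probability.Probability"
begin

definition countably_generated :: "'a measure \<Rightarrow> bool" where
  "countably_generated M \<longleftrightarrow>
     (\<exists>G. countable G \<and> G \<subseteq> Pow (space M) \<and> sets M = sigma_sets (space M) G)"

text \<open>A sub-stochastic chain may leave the state space; from then on its value is \<^term>\<open>None\<close>.\<close>

definition with_cemetery :: "'a measure \<Rightarrow> 'a option measure" where
  "with_cemetery M = sigma (insert None (Some ` space M)) {Some ` A | A. A \<in> sets M}"

definition history ::
  "'w measure \<Rightarrow> 'a measure \<Rightarrow> (nat \<Rightarrow> 'w \<Rightarrow> 'a option) \<Rightarrow> nat \<Rightarrow> 'w set set" where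
  "history \<Omega> M \<Phi> n =
     sigma_sets (space \<Omega>)
       (\<Union>i\<le>n. {\<Phi> i -` B \<inter> space \<Omega> | B. B \<in> sets (with_cemetery M)})"

text \<open>
  \<open>Pr x\<close> is the law of the chain started in \<open>x\<close>; of \<open>\<Omega>\<close> only the measurable space matters.
  The initial condition fixes the distribution of \<open>\<Phi> 0\<close> and not its value, because the
  singleton of \<open>x\<close> need not be measurable. The Markov property says that the conditional
  probability of moving into \<open>A\<close>, given the past, is \<open>P (\<Phi> n) A\<close>. It has the value 0 after the
  chain has left, so that the chain almost surely never returns.
\<close>

locale markov_chain =
  fixes M :: "'a measure" and P :: "'a \<Rightarrow> 'a measure"
    and \<Omega> :: "'w measure" and Pr :: "'a \<Rightarrow> 'w measure" and \<Phi> :: "nat \<Rightarrow> 'w \<Rightarrow> 'a option"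
  assumes kernel: "P \<in> M \<rightarrow>\<^sub>M subprob_algebra M"
    and law: "\<And>x. x \<in> space M \<Longrightarrow> Pr x \<in> space (prob_algebra \<Omega>)"
    and process: "\<And>n. \<Phi> n \<in> \<Omega> \<rightarrow>\<^sub>M with_cemetery M"
    and initial: "\<And>x. x \<in> space M \<Longrightarrow>
      distr (Pr x) (with_cemetery M) (\<Phi> 0) = return (with_cemetery M) (Some x)"
    and markov: "\<And>x n E A. x \<in> space M \<Longrightarrow> E \<in> history \<Omega> M \<Phi> n \<Longrightarrow> A \<in> sets M \<Longrightarrow>
      emeasure (Pr x) {\<omega> \<in> E. \<Phi> (Suc n) \<omega> \<in> Some ` A} =
        (\<integral>\<^sup>+\<omega>\<in>E. (case \<Phi> n \<omega> of None \<Rightarrow> 0 | Some y \<Rightarrow> emeasure (P y) A) \<partial>Pr x)"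

definition nstep ::
  "('a \<Rightarrow> 'w measure) \<Rightarrow> (nat \<Rightarrow> 'w \<Rightarrow> 'a option) \<Rightarrow> nat \<Rightarrow> 'a \<Rightarrow> 'a set \<Rightarrow> ennreal" where
  "nstep Pr \<Phi> n x A = emeasure (Pr x) {\<omega> \<in> space (Pr x). \<Phi> n \<omega> \<in> Some ` A}"

definition return_time :: "(nat \<Rightarrow> 'w \<Rightarrow> 'a option) \<Rightarrow> 'a set \<Rightarrow> 'w \<Rightarrow> enat" where
  "return_time \<Phi> A \<omega> = (INF n\<in>{n. 1 \<le> n \<and> \<Phi> n \<omega> \<in> Some ` A}. enat n)"

definition return_prob ::
  "('a \<Rightarrow> 'w measure) \<Rightarrow> (nat \<Rightarrow> 'w \<Rightarrow> 'a option) \<Rightarrow> 'a \<Rightarrow> 'a set \<Rightarrow> ennreal" where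
  "return_prob Pr \<Phi> x A = emeasure (Pr x) {\<omega> \<in> space (Pr x). return_time \<Phi> A \<omega> < \<infinity>}"

definition return_moment ::
  "('a \<Rightarrow> 'w measure) \<Rightarrow> (nat \<Rightarrow> 'w \<Rightarrow> 'a option) \<Rightarrow> nat \<Rightarrow> 'a \<Rightarrow> 'a set \<Rightarrow> ennreal" where
  "return_moment Pr \<Phi> l x A =
     (\<integral>\<^sup>+\<omega>. ennreal_of_enat (return_time \<Phi> A \<omega>) ^ l
            * indicator {\<omega>. return_time \<Phi> A \<omega> < \<infinity>} \<omega> \<partial>Pr x)"

definition irreducibility_measure ::
  "'a measure \<Rightarrow> ('a \<Rightarrow> 'w measure) \<Rightarrow> (nat \<Rightarrow> 'w \<Rightarrow> 'a option) \<Rightarrow> 'a measure \<Rightarrow> bool" where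
  "irreducibility_measure M Pr \<Phi> \<phi> \<longleftrightarrow>
     sets \<phi> = sets M \<and> sigma_finite_measure \<phi> \<and> emeasure \<phi> (space M) > 0 \<and>
     (\<forall>A\<in>sets M. emeasure \<phi> A > 0 \<longrightarrow> (\<forall>x\<in>space M. \<exists>n\<ge>1. nstep Pr \<Phi> n x A > 0))"

definition psi_irreducible ::
  "'a measure \<Rightarrow> ('a \<Rightarrow> 'w measure) \<Rightarrow> (nat \<Rightarrow> 'w \<Rightarrow> 'a option) \<Rightarrow> 'a measure \<Rightarrow> bool" where
  "psi_irreducible M Pr \<Phi> \<psi> \<longleftrightarrow>
     irreducibility_measure M Pr \<Phi> \<psi> \<and>
     (\<forall>\<phi>. irreducibility_measure M Pr \<Phi> \<phi> \<longrightarrow> absolutely_continuous \<psi> \<phi>)"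

definition pos_sets :: "'a measure \<Rightarrow> 'a measure \<Rightarrow> 'a set set" where
  "pos_sets M \<psi> = {A \<in> sets M. emeasure \<psi> A > 0}"

definition uniformly_transient ::
  "'a measure \<Rightarrow> ('a \<Rightarrow> 'w measure) \<Rightarrow> (nat \<Rightarrow> 'w \<Rightarrow> 'a option) \<Rightarrow> 'a measure \<Rightarrow> nat \<Rightarrow> 'a set \<Rightarrow> bool"
  where
  "uniformly_transient M Pr \<Phi> \<psi> l A \<longleftrightarrow>
     A \<in> pos_sets M \<psi> \<and>
     (SUP x\<in>A. \<Sum>n. of_nat (Suc n) ^ l * nstep Pr \<Phi> (Suc n) x A) < \<infinity>"

definition transient_chain ::
  "'a measure \<Rightarrow> ('a \<Rightarrow> 'w measure) \<Rightarrow> (nat \<Rightarrow> 'w \<Rightarrow> 'a option) \<Rightarrow> 'a measure \<Rightarrow> nat \<Rightarrow> bool" where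
  "transient_chain M Pr \<Phi> \<psi> l \<longleftrightarrow>
     psi_irreducible M Pr \<Phi> \<psi> \<and>
     (\<exists>D A. D \<in> sets M \<and> emeasure \<psi> D = 0 \<and> space M = D \<union> (\<Union>i::nat. A i) \<and>
            (\<forall>i. uniformly_transient M Pr \<Phi> \<psi> l (A i)))"

end

theory Submission
  imports Defs
begin

text \<open>
  Write \<open>P g x\<close> for the integral of \<open>g\<close> against \<open>P x\<close>. From (2), rising factorials of the hitting
  time of \<open>A\<close> give drift functions as in (3) for the same \<open>A\<close>. From (3), normalise the drift functions
  to \<open>1\<close> on \<open>A\<close>; each of them dominates the potential of the next one up to a constant factor, and
  the last one, being superharmonic with drift \<open>b < 1\<close> on \<open>A\<close>, dominates the potential of \<open>A\<close>.
  Iterating bounds the moments of order \<open>l\<close> of the occupation times, which is (1).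

  From (1) to (2), if the return probability were \<open>1\<close> at almost every point of \<open>A\<close>, then the
  expected number of visits \<open>U\<close> would satisfy \<open>U \<ge> 1 + inf U\<close> there, hence be infinite; so the
  return probability is at most some \<open>c < 1\<close> on a subset of positive measure, which is the required
  set. From (1) to (4),
  the weighted potential \<open>V = (\<Sum>n. (n + 1) ^ l * P\<^sup>n\<^sup>+\<^sup>1 1\<^sub>A)\<close> is superharmonic, hence finite
  outside a null set, and the sets where \<open>V \<le> m\<close> and \<open>P\<^sup>k\<^sup>+\<^sup>1 1\<^sub>A \<ge> 1 / m\<close> are uniformly transient.
\<close>

section \<open>Binomial weights and extended nonnegative numbers\<close>

lemma ennreal_suminf_split_head: "(\<Sum>n. f n) = f 0 + (\<Sum>n. f (Suc n))" for f :: "nat \<Rightarrow> ennreal"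
  using sums_unique[OF sums_Suc[OF summable_sums[OF summableI]], of f] by (simp add: add.commute)

lemma binomial_Suc_Suc_mult: "Suc l * ((n + Suc l) choose Suc l) = (n + Suc l) * ((n + l) choose l)"
  using Suc_times_binomial_eq[of "n + l" l] by simp

text \<open>In the inductive step, absorption produces the factor \<open>n + Suc l\<close>, which is
  at most \<open>Suc l * Suc n\<close>. Together with the next bound this exchanges powers of time
  for binomial weights up to the factor \<open>fact l\<close>: the moments carry powers, while drift
  functions and iterated potentials carry binomials.\<close>

lemma binomial_le_power: "(n + l) choose l \<le> Suc n ^ l"
proof (induction l)
  case (Suc l)
  have "Suc l * ((n + Suc l) choose Suc l) \<le> (Suc l * Suc n) * Suc n ^ l"
    unfolding binomial_Suc_Suc_mult using Suc by (intro mult_mono) auto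
  then have "Suc l * ((n + Suc l) choose Suc l) \<le> Suc l * (Suc n * Suc n ^ l)"
    by (simp only: mult.assoc)
  then show ?case by (simp only: mult_le_cancel1 power_Suc)
qed simp

lemma power_le_fact_binomial: "n ^ l \<le> fact l * ((n + l) choose l)"
proof (induction l)
  case (Suc l)
  have "n ^ Suc l \<le> (n + Suc l) * (fact l * ((n + l) choose l))"
    unfolding power_Suc using Suc by (intro mult_mono) auto
  also have "\<dots> = fact l * (Suc l * ((n + Suc l) choose Suc l))"
    unfolding binomial_Suc_Suc_mult by (simp add: mult_ac)
  also have "\<dots> = fact (Suc l) * ((n + Suc l) choose Suc l)"
    by (simp only: fact_Suc of_nat_id mult_ac)
  finally show ?case .
qed simp

text \<open>Used to pass from supports to functions: a positive operator that annihilates the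
  indicator of the support annihilates \<open>f\<close>, however large its values are.\<close>

lemma le_top_indicator_support: "x \<in> S \<Longrightarrow> f x \<le> top * indicator {x \<in> S. f x \<noteq> 0} x"
  for f :: "'a \<Rightarrow> ennreal"
  by (cases "f x = 0") simp_all

lemma ennreal_ex_nat_mult_ge_1:
  fixes q :: ennreal
  assumes "q > 0"
  shows "\<exists>m. 1 \<le> of_nat m * q"
proof (cases q)
  case (real r)
  then have "r > 0" using assms by simp
  then obtain m :: nat where "1 < of_nat m * r" using ex_less_of_nat_mult by blast
  then have "ennreal 1 \<le> ennreal (of_nat m * r)" by (intro ennreal_leI) simp
  then show ?thesis using real
    by (intro exI[of _ m]) (simp add: ennreal_mult ennreal_of_nat_eq_real_of_nat)
next
  case top
  then show ?thesis by (intro exI[of _ 1]) simp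
qed

section \<open>The operators of a substochastic kernel\<close>

locale substochastic_kernel =
  fixes M :: "'a measure" and P :: "'a \<Rightarrow> 'a measure"
  assumes kernel: "P \<in> M \<rightarrow>\<^sub>M subprob_algebra M"
begin

definition trans_op :: "('a \<Rightarrow> ennreal) \<Rightarrow> 'a \<Rightarrow> ennreal" where
  "trans_op g x = (\<integral>\<^sup>+y. g y \<partial>P x)"

text \<open>
  With \<open>g = trans_op (indicator A)\<close>, the function \<open>(taboo_op A ^^ n) g\<close> maps \<open>x\<close> to the
  probability that the chain started in \<open>x\<close> returns to \<open>A\<close> for the first time at time \<open>n + 1\<close>.
\<close>

definition taboo_op :: "'a set \<Rightarrow> ('a \<Rightarrow> ennreal) \<Rightarrow> 'a \<Rightarrow> ennreal" where
  "taboo_op A g = trans_op (\<lambda>y. indicator (- A) y * g y)"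

lemma sets_P: "x \<in> space M \<Longrightarrow> sets (P x) = sets M"
  using sets_kernel[OF kernel] .

lemma space_P: "x \<in> space M \<Longrightarrow> space (P x) = space M"
  using sets_P by (rule sets_eq_imp_space_eq)

lemma measurable_P: "x \<in> space M \<Longrightarrow> borel_measurable (P x) = borel_measurable M"
  by (rule measurable_cong_sets) (simp_all add: sets_P)

lemma trans_op_measurable [measurable]:
  "g \<in> borel_measurable M \<Longrightarrow> trans_op g \<in> borel_measurable M"
  unfolding trans_op_def
  by (rule measurable_compose[OF kernel nn_integral_measurable_subprob_algebra])

lemma trans_op_mono:
  "(\<And>y. y \<in> space M \<Longrightarrow> g y \<le> h y) \<Longrightarrow> x \<in> space M \<Longrightarrow> trans_op g x \<le> trans_op h x"
  unfolding trans_op_def by (intro nn_integral_mono) (simp add: space_P)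

lemma trans_op_cong:
  "(\<And>y. y \<in> space M \<Longrightarrow> g y = h y) \<Longrightarrow> x \<in> space M \<Longrightarrow> trans_op g x = trans_op h x"
  unfolding trans_op_def by (intro nn_integral_cong) (simp add: space_P)

lemma trans_op_add:
  "g \<in> borel_measurable M \<Longrightarrow> h \<in> borel_measurable M \<Longrightarrow> x \<in> space M \<Longrightarrow>
    trans_op (\<lambda>y. g y + h y) x = trans_op g x + trans_op h x"
  unfolding trans_op_def by (intro nn_integral_add) (simp_all add: measurable_P)

lemma trans_op_cmult:
  "g \<in> borel_measurable M \<Longrightarrow> x \<in> space M \<Longrightarrow> trans_op (\<lambda>y. c * g y) x = c * trans_op g x"
  unfolding trans_op_def by (intro nn_integral_cmult) (simp_all add: measurable_P)

lemma trans_op_suminf: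
  "(\<And>n. g n \<in> borel_measurable M) \<Longrightarrow> x \<in> space M \<Longrightarrow>
    trans_op (\<lambda>y. \<Sum>n. g n y) x = (\<Sum>n. trans_op (g n) x)"
  unfolding trans_op_def by (intro nn_integral_suminf) (simp_all add: measurable_P)

lemma trans_op_sum:
  "(\<And>n. g n \<in> borel_measurable M) \<Longrightarrow> x \<in> space M \<Longrightarrow>
    trans_op (\<lambda>y. \<Sum>n\<in>I. g n y) x = (\<Sum>n\<in>I. trans_op (g n) x)"
  unfolding trans_op_def by (intro nn_integral_sum) (simp_all add: measurable_P)

lemma trans_op_indicator:
  "A \<in> sets M \<Longrightarrow> x \<in> space M \<Longrightarrow> trans_op (indicator A) x = emeasure (P x) A"
  unfolding trans_op_def by (simp add: sets_P)

lemma trans_op_le_const: "(\<And>y. y \<in> space M \<Longrightarrow> g y \<le> c) \<Longrightarrow> x \<in> space M \<Longrightarrow> trans_op g x \<le> c"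
proof -
  assume *: "\<And>y. y \<in> space M \<Longrightarrow> g y \<le> c" and x: "x \<in> space M"
  interpret subprob_space "P x" using subprob_space_kernel[OF kernel x] .
  have "trans_op g x \<le> trans_op (\<lambda>_. c) x" using * x by (intro trans_op_mono)
  also have "\<dots> = c * emeasure (P x) (space (P x))" by (simp add: trans_op_def)
  also have "\<dots> \<le> c * 1" by (intro mult_left_mono emeasure_space_le_1) simp
  finally show ?thesis by simp
qed

text \<open>With an empty taboo set, facts about powers of \<open>taboo_op\<close> become facts
  about powers of \<open>trans_op\<close>.\<close>

lemma taboo_op_empty: "taboo_op {} = trans_op"
  by (simp add: taboo_op_def fun_eq_iff)

text \<open>The complement is taken in the whole type and need not lie in \<open>sets M\<close>;
  only its trace on \<open>space M\<close> matters for measurability.\<close>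

lemma indicator_Compl_measurable [measurable]:
  "A \<in> sets M \<Longrightarrow> (indicator (- A) :: 'a \<Rightarrow> ennreal) \<in> borel_measurable M"
  by (rule borel_measurable_indicator') (simp add: Compl_eq_Diff_UNIV Diff_Int_distrib2)

lemma taboo_op_measurable [measurable]:
  "A \<in> sets M \<Longrightarrow> g \<in> borel_measurable M \<Longrightarrow> taboo_op A g \<in> borel_measurable M"
  unfolding taboo_op_def by measurable

lemma taboo_pow_measurable [measurable]:
  "A \<in> sets M \<Longrightarrow> g \<in> borel_measurable M \<Longrightarrow> (taboo_op A ^^ n) g \<in> borel_measurable M"
  by (induction n) simp_all

lemma trans_pow_measurable [measurable]:
  "g \<in> borel_measurable M \<Longrightarrow> (trans_op ^^ n) g \<in> borel_measurable M"
  by (induction n) simp_all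

lemma taboo_op_mono:
  "(\<And>y. y \<in> space M \<Longrightarrow> g y \<le> h y) \<Longrightarrow> x \<in> space M \<Longrightarrow> taboo_op A g x \<le> taboo_op A h x"
  unfolding taboo_op_def by (intro trans_op_mono mult_left_mono) simp_all

lemma taboo_op_le: "x \<in> space M \<Longrightarrow> taboo_op A g x \<le> trans_op g x"
  unfolding taboo_op_def by (intro trans_op_mono) (simp_all add: indicator_def)

lemma taboo_op_add:
  assumes [measurable]: "A \<in> sets M" "g \<in> borel_measurable M" "h \<in> borel_measurable M"
    and "x \<in> space M"
  shows "taboo_op A (\<lambda>y. g y + h y) x = taboo_op A g x + taboo_op A h x"
  unfolding taboo_op_def distrib_left using assms(4) by (intro trans_op_add) measurable

lemma taboo_op_cmult:
  assumes [measurable]: "A \<in> sets M" "g \<in> borel_measurable M" and "x \<in> space M"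
  shows "taboo_op A (\<lambda>y. c * g y) x = c * taboo_op A g x"
  unfolding taboo_op_def mult.left_commute[of _ c] using assms(3)
  by (intro trans_op_cmult) measurable

lemma taboo_op_sum:
  assumes [measurable]: "A \<in> sets M" "\<And>n. g n \<in> borel_measurable M" and "x \<in> space M"
  shows "taboo_op A (\<lambda>y. \<Sum>n\<in>I. g n y) x = (\<Sum>n\<in>I. taboo_op A (g n) x)"
  unfolding taboo_op_def sum_distrib_left using assms(3) by (intro trans_op_sum) measurable

lemma taboo_pow_mono:
  "(\<And>y. y \<in> space M \<Longrightarrow> g y \<le> h y) \<Longrightarrow> x \<in> space M \<Longrightarrow>
    (taboo_op A ^^ n) g x \<le> (taboo_op A ^^ n) h x"
  by (induction n arbitrary: x) (simp_all add: taboo_op_mono)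

lemmas trans_pow_mono = taboo_pow_mono[where A = "{}", unfolded taboo_op_empty]

lemma taboo_op_cong:
  "(\<And>y. y \<in> space M \<Longrightarrow> g y = h y) \<Longrightarrow> x \<in> space M \<Longrightarrow> taboo_op A g x = taboo_op A h x"
  unfolding taboo_op_def by (intro trans_op_cong) simp_all

lemma taboo_pow_cong:
  "(\<And>y. y \<in> space M \<Longrightarrow> g y = h y) \<Longrightarrow> x \<in> space M \<Longrightarrow>
    (taboo_op A ^^ n) g x = (taboo_op A ^^ n) h x"
  by (rule antisym; rule taboo_pow_mono) auto

lemma taboo_pow_add:
  assumes [measurable]: "A \<in> sets M" "g \<in> borel_measurable M" "h \<in> borel_measurable M"
  shows "x \<in> space M \<Longrightarrow>
    (taboo_op A ^^ n) (\<lambda>y. g y + h y) x = (taboo_op A ^^ n) g x + (taboo_op A ^^ n) h x"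
proof (induction n arbitrary: x)
  case (Suc n)
  have "(taboo_op A ^^ Suc n) (\<lambda>y. g y + h y) x =
      taboo_op A (\<lambda>y. (taboo_op A ^^ n) g y + (taboo_op A ^^ n) h y) x"
    using Suc by (auto intro: taboo_op_cong)
  also have "\<dots> = (taboo_op A ^^ Suc n) g x + (taboo_op A ^^ Suc n) h x"
    using Suc.prems by (simp add: taboo_op_add)
  finally show ?case .
qed simp

lemma taboo_pow_cmult:
  assumes [measurable]: "A \<in> sets M" "g \<in> borel_measurable M"
  shows "x \<in> space M \<Longrightarrow> (taboo_op A ^^ n) (\<lambda>y. c * g y) x = c * (taboo_op A ^^ n) g x"
proof (induction n arbitrary: x)
  case (Suc n)
  have "(taboo_op A ^^ Suc n) (\<lambda>y. c * g y) x = taboo_op A (\<lambda>y. c * (taboo_op A ^^ n) g y) x"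
    using Suc by (auto intro: taboo_op_cong)
  also have "\<dots> = c * (taboo_op A ^^ Suc n) g x"
    using Suc.prems by (simp add: taboo_op_cmult)
  finally show ?case .
qed simp

lemma trans_pow_cmult:
  "g \<in> borel_measurable M \<Longrightarrow> x \<in> space M \<Longrightarrow>
    (trans_op ^^ n) (\<lambda>y. c * g y) x = c * (trans_op ^^ n) g x"
  using taboo_pow_cmult[of "{}" g x n c] by (simp add: taboo_op_empty)

lemma taboo_pow_le_trans_pow: "x \<in> space M \<Longrightarrow> (taboo_op A ^^ n) g x \<le> (trans_op ^^ n) g x"
proof (induction n arbitrary: x)
  case (Suc n)
  have "(taboo_op A ^^ Suc n) g x \<le> trans_op ((taboo_op A ^^ n) g) x"
    using Suc.prems by (simp add: taboo_op_le)
  also have "\<dots> \<le> (trans_op ^^ Suc n) g x"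
    using Suc by (auto intro: trans_op_mono)
  finally show ?case .
qed simp

lemma trans_pow_suminf:
  assumes [measurable]: "\<And>k. g k \<in> borel_measurable M"
  shows "x \<in> space M \<Longrightarrow> (trans_op ^^ n) (\<lambda>y. \<Sum>k. g k y) x = (\<Sum>k. (trans_op ^^ n) (g k) x)"
proof (induction n arbitrary: x)
  case (Suc n)
  have "(trans_op ^^ Suc n) (\<lambda>y. \<Sum>k. g k y) x = trans_op (\<lambda>y. \<Sum>k. (trans_op ^^ n) (g k) y) x"
    using Suc by (auto intro: trans_op_cong)
  also have "\<dots> = (\<Sum>k. (trans_op ^^ Suc n) (g k) x)"
    using Suc.prems by (simp add: trans_op_suminf)
  finally show ?case .
qed simp

lemma trans_pow_le_superharmonic:
  assumes "\<And>x. x \<in> space M \<Longrightarrow> trans_op v x \<le> v x"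
  shows "x \<in> space M \<Longrightarrow> (trans_op ^^ n) v x \<le> v x"
proof (induction n arbitrary: x)
  case (Suc n)
  have "(trans_op ^^ Suc n) v x \<le> trans_op v x"
    using Suc by (auto intro: trans_op_mono)
  then show ?case using assms[OF Suc.prems] by (rule order_trans)
qed simp

section \<open>From drift functions to moments of the occupation times\<close>

text \<open>
  If \<open>w (j + 1)\<close> dominates \<open>w j\<close> plus its own average off \<open>A\<close>, then a multiple of \<open>w 0\<close>, which
  has strictly negative drift on \<open>A\<close>, repairs the inequality on \<open>A\<close>. So the potential of \<open>w j\<close>
  is at most a multiple of \<open>w (j + 1)\<close>, and iterating from \<open>w 0\<close> bounds the \<open>(l + 1)\<close>-fold
  potential of \<open>A\<close>, in which \<open>P^n\<close> has the weight \<open>(n + l) choose l\<close>.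
\<close>

lemma iterated_potential_bound:
  fixes b d :: real
  assumes [measurable]: "A \<in> sets M" "\<And>j. w j \<in> borel_measurable M"
    and bd: "0 < b" "b < 1" "0 < d"
    and on: "\<And>j x. j \<le> l \<Longrightarrow> x \<in> A \<Longrightarrow> w j x = 1"
    and off0: "\<And>x. x \<in> space M - A \<Longrightarrow> trans_op (w 0) x \<le> w 0 x"
    and off: "\<And>j x. j < l \<Longrightarrow> x \<in> space M - A \<Longrightarrow> w j x + trans_op (w (Suc j)) x \<le> w (Suc j) x"
    and b: "\<And>x. x \<in> A \<Longrightarrow> trans_op (w 0) x \<le> ennreal b"
    and d: "\<And>x. x \<in> A \<Longrightarrow> trans_op (w l) x \<le> ennreal d"
  shows "j \<le> l \<Longrightarrow> \<exists>C::real. \<forall>x\<in>space M. \<forall>N.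
    (\<Sum>n<N. of_nat ((n + j) choose j) * (trans_op ^^ n) (indicator A) x) \<le> ennreal C * w j x"
proof (induction j)
  case 0
  have sp: "A \<subseteq> space M" by (rule sets.sets_into_space) simp
  \<comment> \<open>The solution of \<open>1 + C * b = C\<close>: on \<open>A\<close> the function
    \<open>C * w 0\<close> drops from \<open>C\<close> to at most \<open>C * b\<close> on average,
    and this drop of at least \<open>1\<close> pays for the indicator of \<open>A\<close>.\<close>
  define C where "C = 1 / (1 - b)"
  have C: "C > 0" "1 + C * b = C" using bd by (auto simp: C_def field_simps)
  have step: "indicator A x + trans_op (\<lambda>y. ennreal C * w 0 y) x \<le> ennreal C * w 0 x"
    if x: "x \<in> space M" for x
  proof (cases "x \<in> A")
    case True
    have "trans_op (\<lambda>y. ennreal C * w 0 y) x \<le> ennreal C * ennreal b"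
      using x b[OF True] by (simp add: trans_op_cmult mult_left_mono)
    also have "\<dots> = ennreal (C * b)" using C bd by (simp add: ennreal_mult)
    finally have "indicator A x + trans_op (\<lambda>y. ennreal C * w 0 y) x \<le> ennreal 1 + ennreal (C * b)"
      using True by (simp add: add_left_mono)
    also have "\<dots> = ennreal C" using C bd by (subst ennreal_plus[symmetric]) auto
    finally show ?thesis using True on by simp
  next
    case False
    then show ?thesis using x off0 by (simp add: trans_op_cmult mult_left_mono)
  qed
  \<comment> \<open>Partial sums make this an induction: a sum with one more term is the indicator
    plus the average of the shorter sum.\<close>
  have "(\<Sum>n<N. (trans_op ^^ n) (indicator A) x) \<le> ennreal C * w 0 x" if "x \<in> space M" for x N
    using that
  proof (induction N arbitrary: x)
    case (Suc N)
    have "(\<Sum>n<Suc N. (trans_op ^^ n) (indicator A) x) =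
        indicator A x + trans_op (\<lambda>y. \<Sum>n<N. (trans_op ^^ n) (indicator A) y) x"
      using Suc.prems by (subst trans_op_sum) (simp_all add: sum.lessThan_Suc_shift del: sum.lessThan_Suc)
    also have "\<dots> \<le> indicator A x + trans_op (\<lambda>y. ennreal C * w 0 y) x"
      using Suc by (intro add_left_mono trans_op_mono) auto
    also have "\<dots> \<le> ennreal C * w 0 x" using Suc.prems by (rule step)
    finally show ?case .
  qed simp
  then show ?case by (intro exI[of _ C]) simp
next
  case (Suc j)
  then have j: "j < l" "j \<le> l" by auto
  \<comment> \<open>Monotonicity in the index has two uses: the bound \<open>d\<close> for the last
    function passes to the earlier ones, and the correction by a multiple of \<open>w 0\<close> is
    absorbed into \<open>w (Suc j)\<close> at the end.\<close>
  have w_mono: "w i x \<le> w k x" if "i \<le> k" "k \<le> l" "x \<in> space M" for i k x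
    using that
  proof (induction k rule: dec_induct)
    case (step k)
    have "w k x \<le> w (Suc k) x"
    proof (cases "x \<in> A")
      case True
      then show ?thesis using on step.prems by simp
    next
      case False
      have "w k x \<le> w k x + trans_op (w (Suc k)) x" by simp
      also have "\<dots> \<le> w (Suc k) x" using False step.prems by (intro off) auto
      finally show ?thesis .
    qed
    then show ?case using step by (auto intro: order_trans)
  qed simp
  have d': "trans_op (w (Suc j)) x \<le> ennreal d" if "x \<in> A" for x
  proof -
    have "trans_op (w (Suc j)) x \<le> trans_op (w l) x"
      using that j sets.sets_into_space[OF assms(1)] by (intro trans_op_mono w_mono) auto
    then show ?thesis using d[OF that] by (rule order_trans)
  qed
  \<comment> \<open>The solution of \<open>d + c * b = c\<close>. On \<open>A\<close> the average of
    \<open>w (Suc j)\<close> may be as large as \<open>d\<close>; the drop of \<open>c * w 0\<close>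
    from \<open>c\<close> to at most \<open>c * b\<close> compensates this exactly, so
    \<open>v\<close> satisfies the inequality everywhere.\<close>
  define c where "c = d / (1 - b)"
  have c: "c > 0" "1 + (d + c * b) = 1 + c" using bd by (auto simp: c_def field_simps)
  define v where "v = (\<lambda>x. w (Suc j) x + ennreal c * w 0 x)"
  have [measurable]: "v \<in> borel_measurable M" unfolding v_def by measurable
  have Qv: "trans_op v x = trans_op (w (Suc j)) x + ennreal c * trans_op (w 0) x"
    if "x \<in> space M" for x
    using that unfolding v_def by (simp add: trans_op_add trans_op_cmult)
  have v: "w j x + trans_op v x \<le> v x" if x: "x \<in> space M" for x
  proof (cases "x \<in> A")
    case True
    have "ennreal c * trans_op (w 0) x \<le> ennreal c * ennreal b"
      using b[OF True] by (simp add: mult_left_mono)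
    also have "\<dots> = ennreal (c * b)" using c bd by (simp add: ennreal_mult)
    finally have "w j x + trans_op v x \<le> ennreal 1 + (ennreal d + ennreal (c * b))"
      using True x d'[of x] on[of j x] j by (simp add: Qv add_mono)
    also have "\<dots> = ennreal (1 + c)"
      using c bd by (subst ennreal_plus[symmetric]; (subst ennreal_plus[symmetric])?) auto
    also have "\<dots> = v x"
      using True x on[of "Suc j" x] on[of 0 x] j c by (simp add: v_def)
    finally show ?thesis .
  next
    case False
    have "w j x + trans_op v x = (w j x + trans_op (w (Suc j)) x) + ennreal c * trans_op (w 0) x"
      using x by (simp add: Qv add.assoc)
    also have "\<dots> \<le> v x"
      unfolding v_def using x False j off off0 by (intro add_mono mult_left_mono) auto
    finally show ?thesis .
  qed
  obtain C :: real where C: "\<And>x N. x \<in> space M \<Longrightarrow>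
      (\<Sum>n<N. of_nat ((n + j) choose j) * (trans_op ^^ n) (indicator A) x) \<le> ennreal C * w j x"
    using Suc.IH j by blast
  have step: "ennreal C * w j x + trans_op (\<lambda>y. ennreal C * v y) x \<le> ennreal C * v x"
    if "x \<in> space M" for x
    using v[OF that] that
    by (simp add: trans_op_cmult mult_left_mono distrib_left[symmetric])
  have le_v: "(\<Sum>n<N. of_nat ((n + Suc j) choose Suc j) * (trans_op ^^ n) (indicator A) x)
      \<le> ennreal C * v x" if "x \<in> space M" for x N
    using that
  proof (induction N arbitrary: x)
    case (Suc N)
    let ?u = "\<lambda>n. (trans_op ^^ n) (indicator A :: 'a \<Rightarrow> ennreal)"
    \<comment> \<open>Pascal's rule splits the weight. The first part is the sum of order
      \<open>j\<close>; the second vanishes at \<open>n = 0\<close>, so after a shift it is the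
      average of the same sum with \<open>N\<close> terms.\<close>
    have "(\<Sum>n<Suc N. of_nat ((n + Suc j) choose Suc j) * ?u n x) =
        (\<Sum>n<Suc N. of_nat ((n + j) choose j) * ?u n x) +
        (\<Sum>n<Suc N. of_nat ((n + j) choose Suc j) * ?u n x)"
      by (simp add: sum.distrib distrib_right del: sum.lessThan_Suc)
    also have "(\<Sum>n<Suc N. of_nat ((n + j) choose Suc j) * ?u n x) =
        trans_op (\<lambda>y. \<Sum>n<N. of_nat ((n + Suc j) choose Suc j) * ?u n y) x"
      using Suc.prems
      by (subst trans_op_sum) (simp_all add: sum.lessThan_Suc_shift trans_op_cmult del: sum.lessThan_Suc)
    also have "(\<Sum>n<Suc N. of_nat ((n + j) choose j) * ?u n x) + \<dots> \<le>
        ennreal C * w j x + trans_op (\<lambda>y. ennreal C * v y) x"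
      using Suc by (intro add_mono trans_op_mono C) auto
    also have "\<dots> \<le> ennreal C * v x" using Suc.prems by (rule step)
    finally show ?case .
  qed simp
  show ?case
  \<comment> \<open>The factor \<open>1 + c\<close> comes from \<open>w 0\<close> being at most
    \<open>w (Suc j)\<close>. The constant \<open>C\<close> is an arbitrary real, and
    \<open>ennreal\<close> sends negative reals to 0; taking the maximum makes the product rule
    applicable.\<close>
  proof (intro exI[of _ "max C 0 * (1 + c)"] ballI allI)
    fix x N assume x: "x \<in> space M"
    note le_v[OF x, of N]
    also have "ennreal C * v x \<le> ennreal C * (w (Suc j) x + ennreal c * w (Suc j) x)"
      unfolding v_def using w_mono[of 0 "Suc j" x] Suc.prems x
      by (intro mult_left_mono add_left_mono) auto
    also have "\<dots> = ennreal (max C 0 * (1 + c)) * w (Suc j) x"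
    proof -
      have "ennreal C = ennreal (max C 0)" by (simp add: max_def ennreal_neg)
      moreover have "ennreal (max C 0 * (1 + c)) = ennreal (max C 0) * (1 + ennreal c)"
        using c by (subst ennreal_mult) auto
      ultimately show ?thesis by (simp add: distrib_right distrib_left mult.assoc)
    qed
    finally show "(\<Sum>n<N. of_nat ((n + Suc j) choose Suc j) * (trans_op ^^ n) (indicator A) x)
      \<le> ennreal (max C 0 * (1 + c)) * w (Suc j) x" .
  qed
qed

section \<open>First returns, first hits and rising factorial moments\<close>

definition first_return :: "'a set \<Rightarrow> nat \<Rightarrow> 'a \<Rightarrow> ennreal" where
  "first_return A n = (taboo_op A ^^ n) (trans_op (indicator A))"

text \<open>Hitting, unlike returning, counts time 0: from inside \<open>A\<close> the hitting time
  is 0, and from outside it equals the return time.\<close>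

definition first_hit :: "'a set \<Rightarrow> nat \<Rightarrow> 'a \<Rightarrow> ennreal" where
  "first_hit A n x =
    (case n of 0 \<Rightarrow> indicator A x | Suc m \<Rightarrow> indicator (- A) x * first_return A m x)"

text \<open>
  In terms of the first hitting time \<open>\<sigma>\<close> this is the expectation of
  \<open>(\<sigma> + 1) \<cdots> (\<sigma> + j)\<close> on \<open>\<sigma> < \<infinity>\<close>: the difference operator sends the rising factorial of
  order \<open>j + 1\<close> to \<open>j + 1\<close> times the one of order \<open>j\<close>, so the drift inequality is an equality.
\<close>

definition hit_moment :: "'a set \<Rightarrow> nat \<Rightarrow> 'a \<Rightarrow> ennreal" where
  "hit_moment A j x = (\<Sum>n. of_nat (fact j * ((n + j) choose j)) * first_hit A n x)"

lemma first_return_measurable [measurable]: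
  "A \<in> sets M \<Longrightarrow> first_return A n \<in> borel_measurable M"
  unfolding first_return_def by simp

lemma first_hit_measurable [measurable]:
  assumes [measurable]: "A \<in> sets M"
  shows "first_hit A n \<in> borel_measurable M"
  unfolding first_hit_def by (cases n) simp_all

lemma hit_moment_measurable [measurable]:
  assumes [measurable]: "A \<in> sets M"
  shows "hit_moment A j \<in> borel_measurable M"
  unfolding hit_moment_def by measurable

text \<open>After one step, hitting \<open>A\<close> at time \<open>n\<close> means returning at
  time \<open>n + 1\<close>, and both are indexed by \<open>n\<close>.\<close>

lemma trans_op_first_hit: "trans_op (first_hit A n) = first_return A n"
proof (cases n)
  case 0
  then have "first_hit A n = indicator A" by (simp add: first_hit_def fun_eq_iff)
  then show ?thesis using 0 by (simp add: first_return_def)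
next
  case (Suc m)
  then have "first_hit A n = (\<lambda>x. indicator (- A) x * first_return A m x)"
    by (simp add: first_hit_def fun_eq_iff)
  then show ?thesis using Suc by (simp add: first_return_def taboo_op_def)
qed

lemma trans_op_hit_moment:
  assumes "A \<in> sets M" "x \<in> space M"
  shows "trans_op (hit_moment A j) x =
    (\<Sum>n. of_nat (fact j * ((n + j) choose j)) * first_return A n x)"
proof -
  have "trans_op (hit_moment A j) x =
      (\<Sum>n. trans_op (\<lambda>y. of_nat (fact j * ((n + j) choose j)) * first_hit A n y) x)"
    unfolding hit_moment_def using assms by (intro trans_op_suminf) measurable
  then show ?thesis using assms by (simp add: trans_op_cmult trans_op_first_hit)
qed

lemma hit_moment_in: "x \<in> A \<Longrightarrow> hit_moment A j x = fact j"
proof -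
  assume x: "x \<in> A"
  have "hit_moment A j x = (\<Sum>n\<in>{0}. of_nat (fact j * ((n + j) choose j)) * first_hit A n x)"
    unfolding hit_moment_def using x
    by (intro suminf_finite) (auto simp: first_hit_def split: nat.split)
  then show ?thesis using x by (simp add: first_hit_def)
qed

lemma hit_moment_notin:
  assumes "x \<notin> A"
  shows "hit_moment A j x = (\<Sum>n. of_nat (fact j * ((Suc n + j) choose j)) * first_return A n x)"
proof -
  have "hit_moment A j x = of_nat (fact j * ((0 + j) choose j)) * first_hit A 0 x +
      (\<Sum>n. of_nat (fact j * ((Suc n + j) choose j)) * first_hit A (Suc n) x)"
    unfolding hit_moment_def by (subst ennreal_suminf_split_head) simp
  then show ?thesis using assms by (simp add: first_hit_def)
qed

lemma hit_moment_drift: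
  assumes "A \<in> sets M" "x \<in> space M - A"
  shows "trans_op (hit_moment A (Suc j)) x + of_nat (Suc j) * hit_moment A j x =
    hit_moment A (Suc j) x"
proof -
  \<comment> \<open>Pascal's rule times \<open>fact (Suc j)\<close>: the weight at time
    \<open>n + 1\<close> is the one at time \<open>n\<close> plus \<open>Suc j\<close> times the
    weight of order \<open>j\<close> at time \<open>n + 1\<close>.\<close>
  have "fact (Suc j) * ((Suc n + Suc j) choose Suc j) =
      fact (Suc j) * ((n + Suc j) choose Suc j) + Suc j * (fact j * ((Suc n + j) choose j))" for n
    by (simp add: algebra_simps)
  then have *: "(of_nat (fact (Suc j) * ((Suc n + Suc j) choose Suc j)) :: ennreal) =
      of_nat (fact (Suc j) * ((n + Suc j) choose Suc j)) +
      of_nat (Suc j) * of_nat (fact j * ((Suc n + j) choose j))" for n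
    by (simp only: of_nat_add of_nat_mult)
  have x: "x \<in> space M" "x \<notin> A" using assms by auto
  have "hit_moment A (Suc j) x =
      (\<Sum>n. of_nat (fact (Suc j) * ((n + Suc j) choose Suc j)) * first_return A n x +
        of_nat (Suc j) * (of_nat (fact j * ((Suc n + j) choose j)) * first_return A n x))"
    by (subst hit_moment_notin[OF x(2)], intro suminf_cong) (simp only: * distrib_right mult.assoc)
  also have "\<dots> = trans_op (hit_moment A (Suc j)) x + of_nat (Suc j) * hit_moment A j x"
    unfolding hit_moment_notin[OF x(2), of j] trans_op_hit_moment[OF assms(1) x(1)]
      ennreal_suminf_cmult[symmetric]
    by (rule suminf_add[OF summableI summableI, symmetric])
  finally show ?thesis ..
qed

text \<open>Order 0 is the probability of ever hitting \<open>A\<close>, which is harmonic off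
  \<open>A\<close>.\<close>

lemma hit_moment_0_drift:
  assumes "A \<in> sets M" "x \<in> space M - A"
  shows "trans_op (hit_moment A 0) x = hit_moment A 0 x"
  using assms by (simp add: trans_op_hit_moment hit_moment_notin)

section \<open>First returns and occupation times\<close>

text \<open>Expected number of visits to \<open>A\<close> at times from 1 on; the starting point is
  not counted.\<close>

definition occupation :: "'a set \<Rightarrow> 'a \<Rightarrow> ennreal" where
  "occupation A x = (\<Sum>n. (trans_op ^^ Suc n) (indicator A) x)"

lemma occupation_measurable [measurable]:
  assumes [measurable]: "A \<in> sets M"
  shows "occupation A \<in> borel_measurable M"
  unfolding occupation_def[abs_def] by measurable

lemma first_return_le: "x \<in> space M \<Longrightarrow> first_return A n x \<le> (trans_op ^^ Suc n) (indicator A) x"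
  unfolding first_return_def funpow_Suc_right o_def by (rule taboo_pow_le_trans_pow)

lemma trans_op_occupation:
  assumes [measurable]: "A \<in> sets M" and x: "x \<in> space M"
  shows "occupation A x = trans_op (\<lambda>y. indicator A y + occupation A y) x"
proof -
  have "occupation A x = trans_op (indicator A) x + (\<Sum>n. (trans_op ^^ Suc (Suc n)) (indicator A) x)"
    unfolding occupation_def by (subst ennreal_suminf_split_head) simp
  also have "(\<Sum>n. (trans_op ^^ Suc (Suc n)) (indicator A) x) = trans_op (occupation A) x"
    unfolding occupation_def[abs_def] using x by (simp add: trans_op_suminf)
  finally show ?thesis using x by (simp add: trans_op_add)
qed

text \<open>Visits are split at the first return: a return at \<open>y\<close> contributes that
  visit and the expected number of later ones from \<open>y\<close>. Induction on partial sums
  yields only the lower bound for \<open>occupation\<close>, which suffices.\<close>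

lemma first_return_occupation:
  assumes [measurable]: "A \<in> sets M" and x: "x \<in> space M"
  shows "(\<Sum>n. (taboo_op A ^^ n) (trans_op (\<lambda>y. indicator A y * (1 + occupation A y))) x)
    \<le> occupation A x"
proof (rule suminf_le_const[OF summableI])
  fix N
  let ?g = "\<lambda>y. indicator A y * (1 + occupation A y)"
  show "(\<Sum>n<N. (taboo_op A ^^ n) (trans_op ?g) x) \<le> occupation A x"
    using x
  proof (induction N arbitrary: x)
    case (Suc N)
    have "(\<Sum>n<Suc N. (taboo_op A ^^ n) (trans_op ?g) x) =
        trans_op ?g x + taboo_op A (\<lambda>y. \<Sum>n<N. (taboo_op A ^^ n) (trans_op ?g) y) x"
      using Suc.prems
      by (subst taboo_op_sum) (simp_all add: sum.lessThan_Suc_shift del: sum.lessThan_Suc)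
    also have "\<dots> \<le> trans_op ?g x + taboo_op A (occupation A) x"
      using Suc by (intro add_left_mono taboo_op_mono) auto
    also have "\<dots> = trans_op (\<lambda>y. ?g y + indicator (- A) y * occupation A y) x"
      unfolding taboo_op_def using Suc.prems by (subst trans_op_add) simp_all
    also have "\<dots> = trans_op (\<lambda>y. indicator A y + occupation A y) x"
      using Suc.prems by (intro trans_op_cong) (simp_all add: indicator_def)
    also have "\<dots> = occupation A x"
      using Suc.prems by (subst trans_op_occupation[symmetric]) auto
    finally show ?case .
  qed simp
qed

text \<open>From \<open>A - Z\<close> the chain returns to \<open>A\<close> surely and never meets
  \<open>Z\<close>, so it returns to \<open>A - Z\<close>. A lower bound \<open>m\<close> for the
  expected number of visits on that set thus improves itself to \<open>m + 1\<close>.\<close>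

lemma occupation_eq_top:
  assumes [measurable]: "A \<in> sets M" "Z \<in> sets M"
    and return: "\<And>x. x \<in> A - Z \<Longrightarrow> (\<Sum>n. first_return A n x) \<ge> 1"
    and avoid: "\<And>x n. x \<in> A - Z \<Longrightarrow> (trans_op ^^ Suc n) (indicator Z) x = 0"
    and x: "x \<in> A - Z"
  shows "occupation A x = top"
proof -
  have sp: "A \<subseteq> space M" by (rule sets.sets_into_space) simp
  have "of_nat m \<le> occupation A x" if "x \<in> A - Z" for m x
    using that
  proof (induction m arbitrary: x)
    case (Suc m)
    have x: "x \<in> space M" using Suc.prems sp by auto
    let ?T = "\<lambda>n g. (taboo_op A ^^ n) (trans_op g) x"
    \<comment> \<open>The part of the first return that lands in \<open>Z\<close> is at most the
      probability of being in \<open>Z\<close> at time \<open>n + 1\<close>, which is 0 by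
      \<open>avoid\<close>.\<close>
    have "?T n (indicator A) \<le> ?T n (indicator (A - Z))" for n
    proof -
      have "?T n (indicator A) \<le> ?T n (\<lambda>y. indicator (A - Z) y + indicator Z y)"
        using x by (intro taboo_pow_mono trans_op_mono) (auto simp: indicator_def)
      also have "\<dots> = (taboo_op A ^^ n) (\<lambda>x. trans_op (indicator (A - Z)) x + trans_op (indicator Z) x) x"
        using x by (intro taboo_pow_cong trans_op_add) auto
      also have "\<dots> = ?T n (indicator (A - Z)) + ?T n (indicator Z)"
        using x by (intro taboo_pow_add) auto
      also have "?T n (indicator Z) \<le> (trans_op ^^ n) (trans_op (indicator Z)) x"
        using x by (rule taboo_pow_le_trans_pow)
      also have "\<dots> = 0" using avoid[OF Suc.prems, of n] by (simp add: funpow_swap1)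
      finally show ?thesis by (simp add: add_left_mono)
    qed
    then have *: "1 \<le> (\<Sum>n. ?T n (indicator (A - Z)))"
      using return[OF Suc.prems] unfolding first_return_def
      by (meson order_trans suminf_le summableI)
    have "of_nat (Suc m) \<le> of_nat (Suc m) * (\<Sum>n. ?T n (indicator (A - Z)))"
      using mult_left_mono[OF *, of "of_nat (Suc m)"] by simp
    also have "\<dots> = (\<Sum>n. of_nat (Suc m) * ?T n (indicator (A - Z)))"
      by (rule ennreal_suminf_cmult[symmetric])
    also have "\<dots> = (\<Sum>n. (taboo_op A ^^ n)
        (\<lambda>x. of_nat (Suc m) * trans_op (indicator (A - Z)) x) x)"
      using x by (intro suminf_cong taboo_pow_cmult[symmetric]) auto
    also have "\<dots> = (\<Sum>n. ?T n (\<lambda>y. of_nat (Suc m) * indicator (A - Z) y))"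
      using x by (intro suminf_cong taboo_pow_cong trans_op_cmult[symmetric]) auto
    \<comment> \<open>By the induction hypothesis \<open>1 + occupation A\<close> is at least
      \<open>Suc m\<close> on \<open>A - Z\<close>.\<close>
    also have "\<dots> \<le> (\<Sum>n. ?T n (\<lambda>y. indicator A y * (1 + occupation A y)))"
      using x Suc.IH
      by (intro suminf_le summableI taboo_pow_mono trans_op_mono) (auto simp: indicator_def add_left_mono)
    also have "\<dots> \<le> occupation A x" using x by (intro first_return_occupation) auto
    finally show ?case .
  qed simp
  then have "\<And>m. of_nat m \<le> occupation A x" using x by blast
  then show ?thesis
    by (metis ennreal_Ex_less_of_nat infinity_ennreal_def not_less top.not_eq_extremum)
qed

end

section \<open>Translating path events into the operators\<close>

lemma return_time_eqI:
  assumes "\<forall>i\<in>{1..n}. \<Phi> i \<omega> \<notin> Some ` A" "\<Phi> (Suc n) \<omega> \<in> Some ` A"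
  shows "return_time \<Phi> A \<omega> = enat (Suc n)"
  unfolding return_time_def
proof (rule antisym)
  show "(INF k\<in>{k. 1 \<le> k \<and> \<Phi> k \<omega> \<in> Some ` A}. enat k) \<le> enat (Suc n)"
    using assms by (intro INF_lower) simp
  have "Suc n \<le> k" if "1 \<le> k" "\<Phi> k \<omega> \<in> Some ` A" for k
    using assms(1) that by (meson atLeastAtMost_iff not_less_eq_eq)
  then show "enat (Suc n) \<le> (INF k\<in>{k. 1 \<le> k \<and> \<Phi> k \<omega> \<in> Some ` A}. enat k)"
    by (intro INF_greatest) auto
qed

lemma return_time_cases:
  obtains (never) "return_time \<Phi> A \<omega> = \<infinity>" "\<And>n. \<Phi> (Suc n) \<omega> \<notin> Some ` A"
  | (at) n where "return_time \<Phi> A \<omega> = enat (Suc n)" "\<forall>i\<in>{1..n}. \<Phi> i \<omega> \<notin> Some ` A"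
      "\<Phi> (Suc n) \<omega> \<in> Some ` A"
proof (cases "\<exists>n. \<Phi> (Suc n) \<omega> \<in> Some ` A")
  case True
  define n where "n = (LEAST n. \<Phi> (Suc n) \<omega> \<in> Some ` A)"
  have n: "\<Phi> (Suc n) \<omega> \<in> Some ` A" unfolding n_def using True by (rule LeastI_ex)
  have "\<Phi> i \<omega> \<notin> Some ` A" if "i \<in> {1..n}" for i
  proof -
    obtain k where "i = Suc k" "k < n" using \<open>i \<in> {1..n}\<close> by (cases i) auto
    then show ?thesis
      using not_less_Least[of k "\<lambda>n. \<Phi> (Suc n) \<omega> \<in> Some ` A"] unfolding n_def by simp
  qed
  then show thesis using n by (intro at return_time_eqI) auto
next
  case False
  then have "\<Phi> k \<omega> \<notin> Some ` A" if "1 \<le> k" for k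
    using that by (cases k) auto
  then have "{k. 1 \<le> k \<and> \<Phi> k \<omega> \<in> Some ` A} = {}" by auto
  then have "return_time \<Phi> A \<omega> = \<infinity>"
    unfolding return_time_def by (simp only: image_empty Inf_empty top_enat_def)
  then show thesis using False by (intro never) auto
qed

lemma return_time_eq_iff:
  "return_time \<Phi> A \<omega> = enat (Suc n) \<longleftrightarrow>
    (\<forall>i\<in>{1..n}. \<Phi> i \<omega> \<notin> Some ` A) \<and> \<Phi> (Suc n) \<omega> \<in> Some ` A"
proof
  assume *: "return_time \<Phi> A \<omega> = enat (Suc n)"
  show "(\<forall>i\<in>{1..n}. \<Phi> i \<omega> \<notin> Some ` A) \<and> \<Phi> (Suc n) \<omega> \<in> Some ` A"
  proof (cases rule: return_time_cases[of \<Phi> A \<omega>])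
    case never
    then show ?thesis using * by simp
  next
    case (at k)
    then have "k = n" using * by simp
    then show ?thesis using at(2,3) by blast
  qed
qed (blast intro: return_time_eqI)

lemma return_time_antimono: "A \<subseteq> B \<Longrightarrow> return_time \<Phi> B \<omega> \<le> return_time \<Phi> A \<omega>"
  unfolding return_time_def by (intro INF_superset_mono) auto

section \<open>The state space with an added cemetery point\<close>

lemma space_with_cemetery: "space (with_cemetery M) = insert None (Some ` space M)"
  unfolding with_cemetery_def using sets.sets_into_space by (subst space_measure_of) blast+

lemma sets_with_cemetery:
  "sets (with_cemetery M) =
    sigma_sets (insert None (Some ` space M)) {Some ` A | A. A \<in> sets M}"
  unfolding with_cemetery_def using sets.sets_into_space by (subst sets_measure_of) blast+

lemma Some_image_in_sets: "A \<in> sets M \<Longrightarrow> Some ` A \<in> sets (with_cemetery M)"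
  unfolding sets_with_cemetery by (rule sigma_sets.Basic) auto

lemma None_in_sets: "{None} \<in> sets (with_cemetery M)"
proof -
  have "space (with_cemetery M) - Some ` space M \<in> sets (with_cemetery M)"
    by (intro sets.compl_sets Some_image_in_sets sets.top)
  also have "space (with_cemetery M) - Some ` space M = {None}"
    by (auto simp: space_with_cemetery)
  finally show ?thesis .
qed

text \<open>Functions on the state space are extended by 0 to the cemetery, in accordance with the
  mass lost by the substochastic kernel.\<close>

lemma case_option_measurable:
  assumes g: "g \<in> borel_measurable M"
  shows "case_option (0::ennreal) g \<in> borel_measurable (with_cemetery M)"
proof (rule measurableI)
  fix S :: "ennreal set" assume S: "S \<in> sets borel"
  have "case_option 0 g -` S \<inter> space (with_cemetery M) =
      Some ` (g -` S \<inter> space M) \<union> (if 0 \<in> S then {None} else {})"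
    by (auto simp: space_with_cemetery split: option.splits)
  also have "\<dots> \<in> sets (with_cemetery M)"
    using measurable_sets[OF g S] by (intro sets.Un Some_image_in_sets) (auto intro: None_in_sets)
  finally show "case_option 0 g -` S \<inter> space (with_cemetery M) \<in> sets (with_cemetery M)" .
qed simp

section \<open>The Markov property and the law of the return time\<close>

sublocale markov_chain \<subseteq> substochastic_kernel M P
  by unfold_locales (rule kernel)

context markov_chain
begin

lemma sets_Pr: "x \<in> space M \<Longrightarrow> sets (Pr x) = sets \<Omega>"
  using law[of x] by (auto simp: space_prob_algebra)

lemma space_Pr: "x \<in> space M \<Longrightarrow> space (Pr x) = space \<Omega>"
  by (rule sets_eq_imp_space_eq) (rule sets_Pr)

lemma measurable_Pr: "x \<in> space M \<Longrightarrow> measurable (Pr x) N = measurable \<Omega> N"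
  by (rule measurable_cong_sets) (simp_all add: sets_Pr)

lemma Phi_cases:
  assumes "\<omega> \<in> space \<Omega>"
  obtains "\<Phi> n \<omega> = None" | y where "\<Phi> n \<omega> = Some y" "y \<in> space M"
  using measurable_space[OF process assms, of n] by (auto simp: space_with_cemetery)

lemma Phi_fun_measurable [measurable]:
  "g \<in> borel_measurable M \<Longrightarrow> (\<lambda>\<omega>. case_option (0::ennreal) g (\<Phi> n \<omega>)) \<in> borel_measurable \<Omega>"
  by (rule measurable_compose[OF process case_option_measurable])

lemma Phi_event [measurable]: "A \<in> sets M \<Longrightarrow> {\<omega> \<in> space \<Omega>. \<Phi> n \<omega> \<in> Some ` A} \<in> sets \<Omega>"
  using measurable_sets[OF process Some_image_in_sets, of A n] by (simp add: vimage_def Int_def conj_commute)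

lemma sigma_algebra_history: "sigma_algebra (space \<Omega>) (history \<Omega> M \<Phi> n)"
  unfolding history_def by (rule sigma_algebra_sigma_sets) auto

lemma history_subset: "history \<Omega> M \<Phi> n \<subseteq> sets \<Omega>"
  unfolding history_def using measurable_sets[OF process]
  by (intro sets.sigma_sets_subset) auto

text \<open>Time 0 is left out because return times disregard the starting point. For empty
  \<open>A\<close> or for \<open>n = 0\<close> this is the whole sample space.\<close>

definition avoiding :: "'a set \<Rightarrow> nat \<Rightarrow> 'w set" where
  "avoiding A n = {\<omega> \<in> space \<Omega>. \<forall>i\<in>{1..n}. \<Phi> i \<omega> \<notin> Some ` A}"

lemma avoiding_in_history:
  assumes "A \<in> sets M"
  shows "avoiding A n \<in> history \<Omega> M \<Phi> n"
proof -
  interpret sigma_algebra "space \<Omega>" "history \<Omega> M \<Phi> n" by (rule sigma_algebra_history)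
  have "\<Phi> i -` (Some ` A) \<inter> space \<Omega> \<in> history \<Omega> M \<Phi> n" if "i \<le> n" for i
    unfolding history_def using that Some_image_in_sets[OF assms] by (intro sigma_sets.Basic) auto
  then have "space \<Omega> - (\<Union>i\<in>{1..n}. \<Phi> i -` (Some ` A) \<inter> space \<Omega>) \<in> history \<Omega> M \<Phi> n"
    by (intro compl_sets finite_UN) auto
  also have "space \<Omega> - (\<Union>i\<in>{1..n}. \<Phi> i -` (Some ` A) \<inter> space \<Omega>) = avoiding A n"
    by (auto simp: avoiding_def)
  finally show ?thesis .
qed

lemma avoiding_measurable [measurable]: "A \<in> sets M \<Longrightarrow> avoiding A n \<in> sets \<Omega>"
  using avoiding_in_history history_subset by blast

text \<open>The Markov property is assumed for target sets only; with the past event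
  \<open>E\<close> fixed, it extends through simple functions and monotone limits to nonnegative
  measurable functions.\<close>

lemma markov_fun:
  assumes x: "x \<in> space M" and E: "E \<in> history \<Omega> M \<Phi> n" and g: "g \<in> borel_measurable M"
  shows "(\<integral>\<^sup>+\<omega>\<in>E. case_option 0 g (\<Phi> (Suc n) \<omega>) \<partial>Pr x) =
    (\<integral>\<^sup>+\<omega>\<in>E. case_option 0 (trans_op g) (\<Phi> n \<omega>) \<partial>Pr x)"
proof -
  have [measurable]: "E \<in> sets (Pr x)" using E history_subset x by (auto simp: sets_Pr)
  have meas: "(\<lambda>\<omega>. case_option 0 g (\<Phi> k \<omega>) * indicator E \<omega> :: ennreal) \<in> borel_measurable (Pr x)"
    if "g \<in> borel_measurable M" for g k
  proof -
    have [measurable]: "(\<lambda>\<omega>. case_option (0::ennreal) g (\<Phi> k \<omega>)) \<in> borel_measurable (Pr x)"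
      using Phi_fun_measurable[OF that] x by (simp add: measurable_Pr)
    show ?thesis by measurable
  qed
  note space_Pr[OF x, simp]
  show ?thesis using g
  proof (induction rule: borel_measurable_induct)
    case (cong f g)
    have "case_option 0 f (\<Phi> (Suc n) \<omega>) = case_option 0 g (\<Phi> (Suc n) \<omega>)" if "\<omega> \<in> space \<Omega>" for \<omega>
      using that cong(3) by (cases rule: Phi_cases[of \<omega> "Suc n"]) auto
    moreover have "case_option 0 (trans_op f) (\<Phi> n \<omega>) = case_option 0 (trans_op g) (\<Phi> n \<omega>)"
      if "\<omega> \<in> space \<Omega>" for \<omega>
      using that cong(3) by (cases rule: Phi_cases[of \<omega> n]) (auto intro: trans_op_cong)
    ultimately have
      "(\<integral>\<^sup>+\<omega>\<in>E. case_option 0 f (\<Phi> (Suc n) \<omega>) \<partial>Pr x) =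
        (\<integral>\<^sup>+\<omega>\<in>E. case_option 0 g (\<Phi> (Suc n) \<omega>) \<partial>Pr x)"
      "(\<integral>\<^sup>+\<omega>\<in>E. case_option 0 (trans_op f) (\<Phi> n \<omega>) \<partial>Pr x) =
        (\<integral>\<^sup>+\<omega>\<in>E. case_option 0 (trans_op g) (\<Phi> n \<omega>) \<partial>Pr x)"
      by (intro nn_integral_cong; simp)+
    then show ?case using cong(4) by metis
  next
    case (set A)
    have [measurable]: "{\<omega> \<in> E. \<Phi> (Suc n) \<omega> \<in> Some ` A} \<in> sets (Pr x)"
    proof -
      have "{\<omega> \<in> E. \<Phi> (Suc n) \<omega> \<in> Some ` A} = E \<inter> {\<omega> \<in> space \<Omega>. \<Phi> (Suc n) \<omega> \<in> Some ` A}"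
        using E history_subset sets.sets_into_space by blast
      also have "\<dots> \<in> sets (Pr x)"
        using Phi_event[OF set, of "Suc n"] E history_subset
        unfolding sets_Pr[OF x] by (intro sets.Int) auto
      finally show ?thesis .
    qed
    have "(\<integral>\<^sup>+\<omega>\<in>E. case_option 0 (indicator A) (\<Phi> (Suc n) \<omega>) \<partial>Pr x) =
        (\<integral>\<^sup>+\<omega>. indicator {\<omega> \<in> E. \<Phi> (Suc n) \<omega> \<in> Some ` A} \<omega> \<partial>Pr x)"
      by (intro nn_integral_cong) (auto simp: indicator_def split: option.split)
    also have "\<dots> = (\<integral>\<^sup>+\<omega>\<in>E. (case \<Phi> n \<omega> of None \<Rightarrow> 0 | Some y \<Rightarrow> emeasure (P y) A) \<partial>Pr x)"
      using markov[OF x E set] by simp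
    also have "\<dots> = (\<integral>\<^sup>+\<omega>\<in>E. case_option 0 (trans_op (indicator A)) (\<Phi> n \<omega>) \<partial>Pr x)"
    proof (intro nn_integral_cong)
      fix \<omega> assume "\<omega> \<in> space (Pr x)"
      then have "\<omega> \<in> space \<Omega>" by simp
      then show "(case \<Phi> n \<omega> of None \<Rightarrow> 0 | Some y \<Rightarrow> emeasure (P y) A) * indicator E \<omega> =
          case_option 0 (trans_op (indicator A)) (\<Phi> n \<omega>) * indicator E \<omega>"
        using set by (cases rule: Phi_cases[of \<omega> n]) (auto simp: trans_op_indicator)
    qed
    finally show ?case .
  next
    case (mult u c)
    have "(\<integral>\<^sup>+\<omega>\<in>E. case_option 0 (\<lambda>y. c * u y) (\<Phi> (Suc n) \<omega>) \<partial>Pr x) =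
        (\<integral>\<^sup>+\<omega>. c * (case_option 0 u (\<Phi> (Suc n) \<omega>) * indicator E \<omega>) \<partial>Pr x)"
      by (intro nn_integral_cong) (auto simp: mult.assoc split: option.split)
    also have "\<dots> = c * (\<integral>\<^sup>+\<omega>\<in>E. case_option 0 u (\<Phi> (Suc n) \<omega>) \<partial>Pr x)"
      using mult(2) by (intro nn_integral_cmult meas)
    also have "\<dots> = c * (\<integral>\<^sup>+\<omega>\<in>E. case_option 0 (trans_op u) (\<Phi> n \<omega>) \<partial>Pr x)"
      using mult by simp
    also have "\<dots> = (\<integral>\<^sup>+\<omega>. c * (case_option 0 (trans_op u) (\<Phi> n \<omega>) * indicator E \<omega>) \<partial>Pr x)"
      using mult(2) by (intro nn_integral_cmult[symmetric] meas trans_op_measurable)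
    also have "\<dots> = (\<integral>\<^sup>+\<omega>\<in>E. case_option 0 (trans_op (\<lambda>y. c * u y)) (\<Phi> n \<omega>) \<partial>Pr x)"
    proof (intro nn_integral_cong)
      fix \<omega> assume "\<omega> \<in> space (Pr x)"
      then have "\<omega> \<in> space \<Omega>" by simp
      then show "c * (case_option 0 (trans_op u) (\<Phi> n \<omega>) * indicator E \<omega>) =
          case_option 0 (trans_op (\<lambda>y. c * u y)) (\<Phi> n \<omega>) * indicator E \<omega>"
        using mult(2) by (cases rule: Phi_cases[of \<omega> n]) (auto simp: trans_op_cmult mult.assoc)
    qed
    finally show ?case .
  next
    case (add u v)
    have "(\<integral>\<^sup>+\<omega>\<in>E. case_option 0 (\<lambda>y. v y + u y) (\<Phi> (Suc n) \<omega>) \<partial>Pr x) =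
        (\<integral>\<^sup>+\<omega>. case_option 0 v (\<Phi> (Suc n) \<omega>) * indicator E \<omega> +
          case_option 0 u (\<Phi> (Suc n) \<omega>) * indicator E \<omega> \<partial>Pr x)"
      by (intro nn_integral_cong) (auto simp: distrib_right split: option.split)
    also have "\<dots> = (\<integral>\<^sup>+\<omega>\<in>E. case_option 0 v (\<Phi> (Suc n) \<omega>) \<partial>Pr x) +
        (\<integral>\<^sup>+\<omega>\<in>E. case_option 0 u (\<Phi> (Suc n) \<omega>) \<partial>Pr x)"
      using add by (intro nn_integral_add meas)
    also have "\<dots> = (\<integral>\<^sup>+\<omega>\<in>E. case_option 0 (trans_op v) (\<Phi> n \<omega>) \<partial>Pr x) +
        (\<integral>\<^sup>+\<omega>\<in>E. case_option 0 (trans_op u) (\<Phi> n \<omega>) \<partial>Pr x)"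
      using add by simp
    also have "\<dots> = (\<integral>\<^sup>+\<omega>. case_option 0 (trans_op v) (\<Phi> n \<omega>) * indicator E \<omega> +
          case_option 0 (trans_op u) (\<Phi> n \<omega>) * indicator E \<omega> \<partial>Pr x)"
      using add by (intro nn_integral_add[symmetric] meas trans_op_measurable)
    also have "\<dots> = (\<integral>\<^sup>+\<omega>\<in>E. case_option 0 (trans_op (\<lambda>y. v y + u y)) (\<Phi> n \<omega>) \<partial>Pr x)"
    proof (intro nn_integral_cong)
      fix \<omega> assume "\<omega> \<in> space (Pr x)"
      then have "\<omega> \<in> space \<Omega>" by simp
      then show "case_option 0 (trans_op v) (\<Phi> n \<omega>) * indicator E \<omega> +
            case_option 0 (trans_op u) (\<Phi> n \<omega>) * indicator E \<omega> =
          case_option 0 (trans_op (\<lambda>y. v y + u y)) (\<Phi> n \<omega>) * indicator E \<omega>"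
        using add by (cases rule: Phi_cases[of \<omega> n]) (auto simp: trans_op_add distrib_right)
    qed
    finally show ?case .
  next
    case (seq U)
    have inc: "incseq (\<lambda>i \<omega>. case_option 0 (U i) (\<Phi> k \<omega>) * indicator E \<omega> :: ennreal)"
      if "incseq U" for U :: "nat \<Rightarrow> 'a \<Rightarrow> ennreal" and k
      using that by (auto simp: incseq_def le_fun_def intro!: mult_right_mono split: option.split)
    have inc_Q: "trans_op (U i) y \<le> trans_op (U j) y" if "i \<le> j" "y \<in> space M" for i j y
      using that seq(3) by (auto intro!: trans_op_mono simp: incseq_def le_fun_def)
    have "(\<integral>\<^sup>+\<omega>\<in>E. case_option 0 (SUP i. U i) (\<Phi> (Suc n) \<omega>) \<partial>Pr x) =
        (\<integral>\<^sup>+\<omega>. (SUP i. case_option 0 (U i) (\<Phi> (Suc n) \<omega>) * indicator E \<omega>) \<partial>Pr x)"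
      by (intro nn_integral_cong) (auto simp: indicator_def image_comp split: option.split)
    also have "\<dots> = (SUP i. \<integral>\<^sup>+\<omega>\<in>E. case_option 0 (U i) (\<Phi> (Suc n) \<omega>) \<partial>Pr x)"
      using seq(1) by (intro nn_integral_monotone_convergence_SUP inc seq(3) meas)
    also have "\<dots> = (SUP i. \<integral>\<^sup>+\<omega>\<in>E. case_option 0 (trans_op (U i)) (\<Phi> n \<omega>) \<partial>Pr x)"
      using seq by simp
    also have "\<dots> = (\<integral>\<^sup>+\<omega>. (SUP i. case_option 0 (trans_op (U i)) (\<Phi> n \<omega>) * indicator E \<omega>) \<partial>Pr x)"
    \<comment> \<open>\<open>inc_Q\<close> gives monotonicity at points of \<open>space M\<close>,
      hence along paths in the sample space; the almost everywhere form of monotone convergence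
      accepts this.\<close>
    proof (intro nn_integral_monotone_convergence_SUP_AE[symmetric])
      fix i
      show "AE \<omega> in Pr x. case_option 0 (trans_op (U i)) (\<Phi> n \<omega>) * indicator E \<omega>
        \<le> case_option 0 (trans_op (U (Suc i))) (\<Phi> n \<omega>) * indicator E \<omega>"
      proof (rule AE_I2)
        fix \<omega> assume "\<omega> \<in> space (Pr x)"
        then have "\<omega> \<in> space \<Omega>" by simp
        then show "case_option 0 (trans_op (U i)) (\<Phi> n \<omega>) * indicator E \<omega>
            \<le> case_option 0 (trans_op (U (Suc i))) (\<Phi> n \<omega>) * indicator E \<omega>"
          by (cases rule: Phi_cases[of \<omega> n]) (auto intro!: mult_right_mono inc_Q)
      qed
      show "(\<lambda>\<omega>. case_option 0 (trans_op (U i)) (\<Phi> n \<omega>) * indicator E \<omega>) \<in> borel_measurable (Pr x)"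
        using seq(1) by (intro meas trans_op_measurable)
    qed
    also have "\<dots> = (\<integral>\<^sup>+\<omega>\<in>E. case_option 0 (trans_op (SUP i. U i)) (\<Phi> n \<omega>) \<partial>Pr x)"
    proof (intro nn_integral_cong)
      fix \<omega> assume "\<omega> \<in> space (Pr x)"
      then have \<omega>: "\<omega> \<in> space \<Omega>" by simp
      have "trans_op (SUP i. U i) y = (SUP i. trans_op (U i) y)" if "y \<in> space M" for y
        unfolding trans_op_def SUP_apply using that seq
        by (intro nn_integral_monotone_convergence_SUP) (auto simp: measurable_P)
      then show "(SUP i. case_option 0 (trans_op (U i)) (\<Phi> n \<omega>) * indicator E \<omega>) =
          case_option 0 (trans_op (SUP i. U i)) (\<Phi> n \<omega>) * indicator E \<omega>"
        by (cases rule: Phi_cases[OF \<omega>, of n]) (auto simp: indicator_def)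
    qed
    finally show ?case .
  qed
qed

text \<open>Links paths to operators. The Markov property removes the last step, and avoidance of
  \<open>A\<close> at the time before it moves from the event into the function; hence the induction
  varies \<open>g\<close>.\<close>

lemma taboo_law:
  assumes x: "x \<in> space M" and A [measurable]: "A \<in> sets M"
  shows "g \<in> borel_measurable M \<Longrightarrow>
    (\<integral>\<^sup>+\<omega>\<in>avoiding A n. case_option 0 g (\<Phi> (Suc n) \<omega>) \<partial>Pr x) = (taboo_op A ^^ n) (trans_op g) x"
proof (induction n arbitrary: g)
  case 0
  have "(\<integral>\<^sup>+\<omega>\<in>avoiding A 0. case_option 0 g (\<Phi> (Suc 0) \<omega>) \<partial>Pr x) =
      (\<integral>\<^sup>+\<omega>\<in>avoiding A 0. case_option 0 (trans_op g) (\<Phi> 0 \<omega>) \<partial>Pr x)"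
    using 0 by (intro markov_fun x avoiding_in_history A)
  also have "\<dots> = (\<integral>\<^sup>+\<omega>. case_option 0 (trans_op g) (\<Phi> 0 \<omega>) \<partial>Pr x)"
    by (intro nn_integral_cong) (simp add: avoiding_def space_Pr x)
  \<comment> \<open>Only the distribution of the starting point is prescribed, so the integral is
    transported to the state space, where it is taken against a point mass.\<close>
  also have "\<dots> = (\<integral>\<^sup>+z. case_option 0 (trans_op g) z \<partial>distr (Pr x) (with_cemetery M) (\<Phi> 0))"
    using process x case_option_measurable[OF trans_op_measurable[OF 0]]
    by (intro nn_integral_distr[symmetric]) (auto simp: measurable_Pr)
  also have "\<dots> = trans_op g x"
    unfolding initial[OF x] using 0 x
    by (subst nn_integral_return) (auto simp: space_with_cemetery intro!: case_option_measurable)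
  finally show ?case by simp
next
  case (Suc n)
  note [measurable] = Suc.prems
  have "(\<integral>\<^sup>+\<omega>\<in>avoiding A (Suc n). case_option 0 g (\<Phi> (Suc (Suc n)) \<omega>) \<partial>Pr x) =
      (\<integral>\<^sup>+\<omega>\<in>avoiding A (Suc n). case_option 0 (trans_op g) (\<Phi> (Suc n) \<omega>) \<partial>Pr x)"
    by (intro markov_fun x avoiding_in_history A Suc.prems)
  also have "\<dots> = (\<integral>\<^sup>+\<omega>\<in>avoiding A n.
      case_option 0 (\<lambda>y. indicator (- A) y * trans_op g y) (\<Phi> (Suc n) \<omega>) \<partial>Pr x)"
    by (intro nn_integral_cong)
      (auto simp: avoiding_def indicator_def atLeastAtMostSuc_conv split: option.split)
  also have "\<dots> = (taboo_op A ^^ n) (taboo_op A (trans_op g)) x"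
    unfolding taboo_op_def[of A "trans_op g"] by (intro Suc.IH) measurable
  finally show ?case by (simp add: funpow_swap1)
qed

lemma nstep_Suc:
  assumes x: "x \<in> space M" and A: "A \<in> sets M"
  shows "nstep Pr \<Phi> (Suc n) x A = (trans_op ^^ Suc n) (indicator A) x"
proof -
  have "nstep Pr \<Phi> (Suc n) x A = (\<integral>\<^sup>+\<omega>. indicator {\<omega> \<in> space \<Omega>. \<Phi> (Suc n) \<omega> \<in> Some ` A} \<omega> \<partial>Pr x)"
    unfolding nstep_def using x A by (simp add: space_Pr sets_Pr)
  also have "\<dots> = (\<integral>\<^sup>+\<omega>\<in>avoiding {} n. case_option 0 (indicator A) (\<Phi> (Suc n) \<omega>) \<partial>Pr x)"
    by (intro nn_integral_cong)
      (auto simp: avoiding_def indicator_def space_Pr x split: option.split)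
  also have "\<dots> = (trans_op ^^ n) (trans_op (indicator A)) x"
    using x A by (simp add: taboo_law taboo_op_empty)
  finally show ?thesis by (simp add: funpow_swap1)
qed

text \<open>Splitting by the value of the return time leaves no term for paths that never return,
  hence \<open>h \<infinity> = 0\<close>. Both the return probability and the return moments are
  instances.\<close>

lemma return_time_integral:
  fixes h :: "enat \<Rightarrow> ennreal"
  assumes x: "x \<in> space M" and A [measurable]: "A \<in> sets M" and h: "h \<infinity> = 0"
  shows "(\<integral>\<^sup>+\<omega>. h (return_time \<Phi> A \<omega>) \<partial>Pr x) = (\<Sum>n. h (enat (Suc n)) * first_return A n x)"
proof -
  let ?f = "\<lambda>n \<omega>. case_option 0 (indicator A) (\<Phi> (Suc n) \<omega>) * indicator (avoiding A n) \<omega> :: ennreal"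
  have [measurable]: "?f n \<in> borel_measurable (Pr x)" for n
    using x by (simp add: measurable_Pr)
  have f: "?f n \<omega> = of_bool (return_time \<Phi> A \<omega> = enat (Suc n))" if "\<omega> \<in> space \<Omega>" for n \<omega>
    using that by (auto simp: return_time_eq_iff avoiding_def indicator_def split: option.split)
  have "h (return_time \<Phi> A \<omega>) = (\<Sum>n. h (enat (Suc n)) * ?f n \<omega>)" if \<omega>: "\<omega> \<in> space \<Omega>" for \<omega>
  proof (cases rule: return_time_cases[of \<Phi> A \<omega>])
    case never
    then show ?thesis using \<omega> h by (simp add: f)
  next
    case (at n)
    then have "(\<Sum>k. h (enat (Suc k)) * ?f k \<omega>) = (\<Sum>k\<in>{n}. h (enat (Suc k)) * ?f k \<omega>)"
      unfolding f[OF \<omega>] by (intro suminf_finite) auto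
    then show ?thesis using at(1) by (simp add: f[OF \<omega>])
  qed
  then have "(\<integral>\<^sup>+\<omega>. h (return_time \<Phi> A \<omega>) \<partial>Pr x) = (\<integral>\<^sup>+\<omega>. (\<Sum>n. h (enat (Suc n)) * ?f n \<omega>) \<partial>Pr x)"
    using x by (intro nn_integral_cong) (simp add: space_Pr)
  also have "\<dots> = (\<Sum>n. h (enat (Suc n)) * (\<integral>\<^sup>+\<omega>. ?f n \<omega> \<partial>Pr x))"
    by (simp add: nn_integral_suminf nn_integral_cmult)
  also have "\<dots> = (\<Sum>n. h (enat (Suc n)) * first_return A n x)"
    using x A by (simp add: taboo_law first_return_def)
  finally show ?thesis .
qed

lemma return_event:
  assumes "x \<in> space M" "A \<in> sets M"
  shows "{\<omega> \<in> space (Pr x). return_time \<Phi> A \<omega> < \<infinity>} \<in> sets (Pr x)"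
proof -
  have "{\<omega> \<in> space (Pr x). return_time \<Phi> A \<omega> < \<infinity>} =
      (\<Union>n. {\<omega> \<in> space \<Omega>. \<Phi> (Suc n) \<omega> \<in> Some ` A})"
  proof (intro set_eqI)
    fix \<omega>
    show "\<omega> \<in> {\<omega> \<in> space (Pr x). return_time \<Phi> A \<omega> < \<infinity>} \<longleftrightarrow>
        \<omega> \<in> (\<Union>n. {\<omega> \<in> space \<Omega>. \<Phi> (Suc n) \<omega> \<in> Some ` A})"
      using assms by (cases rule: return_time_cases[of \<Phi> A \<omega>]) (auto simp: space_Pr)
  qed
  then show ?thesis using assms by (auto simp: sets_Pr)
qed

lemma return_prob_eq:
  assumes "x \<in> space M" "A \<in> sets M"
  shows "return_prob Pr \<Phi> x A = (\<Sum>n. first_return A n x)"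
proof -
  have "return_prob Pr \<Phi> x A =
      (\<integral>\<^sup>+\<omega>. indicator {\<omega> \<in> space (Pr x). return_time \<Phi> A \<omega> < \<infinity>} \<omega> \<partial>Pr x)"
    unfolding return_prob_def using return_event[OF assms] by simp
  also have "\<dots> = (\<integral>\<^sup>+\<omega>. indicator {..<\<infinity>} (return_time \<Phi> A \<omega>) \<partial>Pr x)"
    by (intro nn_integral_cong) (simp add: indicator_def)
  also have "\<dots> = (\<Sum>n. first_return A n x)"
    using return_time_integral[OF assms, of "indicator {..<\<infinity>}"] by simp
  finally show ?thesis .
qed

lemma return_moment_eq:
  assumes "x \<in> space M" "A \<in> sets M"
  shows "return_moment Pr \<Phi> l x A = (\<Sum>n. of_nat (Suc n) ^ l * first_return A n x)"
proof -
  have "return_moment Pr \<Phi> l x A =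
      (\<integral>\<^sup>+\<omega>. (\<lambda>t. ennreal_of_enat t ^ l * indicator {..<\<infinity>} t) (return_time \<Phi> A \<omega>) \<partial>Pr x)"
    unfolding return_moment_def by (intro nn_integral_cong) (simp add: indicator_def)
  also have "\<dots> = (\<Sum>n. of_nat (Suc n) ^ l * first_return A n x)"
    by (subst return_time_integral[OF assms]) simp_all
  finally show ?thesis .
qed

lemma return_prob_mono:
  assumes "x \<in> space M" "B \<in> sets M" "A \<subseteq> B"
  shows "return_prob Pr \<Phi> x A \<le> return_prob Pr \<Phi> x B"
  unfolding return_prob_def
proof (intro emeasure_mono return_event assms(1,2) subsetI CollectI conjI; elim CollectE conjE)
  fix \<omega> assume "return_time \<Phi> A \<omega> < \<infinity>"
  then show "return_time \<Phi> B \<omega> < \<infinity>"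
    using return_time_antimono[OF assms(3)] by (rule order.strict_trans1[rotated])
qed

section \<open>Null sets of a maximal irreducibility measure\<close>

lemma irreducible_hits:
  assumes "psi_irreducible M Pr \<Phi> \<psi>" "A \<in> sets M" "emeasure \<psi> A > 0" "x \<in> space M"
  shows "\<exists>n. (trans_op ^^ Suc n) (indicator A) x > 0"
proof -
  obtain n where "n \<ge> 1" "nstep Pr \<Phi> n x A > 0"
    using assms unfolding psi_irreducible_def irreducibility_measure_def by blast
  then show ?thesis using assms nstep_Suc[of x A "n - 1"] by (intro exI[of _ "n - 1"]) simp
qed

text \<open>The zero set of a superharmonic function cannot be left within the state space: the
  indicator of its complement is at most infinity times \<open>v\<close>, and the powers of the
  operator keep \<open>v\<close> at 0 there.\<close>

lemma trans_pow_superharmonic_zero: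
  assumes [measurable]: "v \<in> borel_measurable M"
    and le: "\<And>x. x \<in> space M \<Longrightarrow> trans_op v x \<le> v x"
    and x: "x \<in> space M" "v x = 0"
  shows "(trans_op ^^ n) (indicator {x \<in> space M. v x \<noteq> 0}) x = 0"
proof -
  have "(trans_op ^^ n) (indicator {x \<in> space M. v x \<noteq> 0}) x \<le> (trans_op ^^ n) (\<lambda>y. top * v y) x"
    using x by (intro trans_pow_mono) (auto simp: indicator_def ennreal_top_mult)
  also have "\<dots> = top * (trans_op ^^ n) v x"
    using x by (intro trans_pow_cmult) auto
  also have "(trans_op ^^ n) v x = 0"
    using trans_pow_le_superharmonic[OF le x(1), of n] x by simp
  finally show ?thesis by simp
qed

text \<open>
  If \<open>\<psi>\<close> is an irreducibility measure, then so is the image under the kernel of a finite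
  measure equivalent to \<open>\<psi>\<close>; maximality makes it absolutely continuous with respect to \<open>\<psi>\<close>.
\<close>

lemma null_set_trans_op:
  assumes irr: "psi_irreducible M Pr \<Phi> \<psi>" and N: "N \<in> sets M" "emeasure \<psi> N = 0"
  shows "emeasure \<psi> {x \<in> space M. trans_op (indicator N) x \<noteq> 0} = 0"
proof -
  have \<psi>: "sets \<psi> = sets M" "sigma_finite_measure \<psi>" "emeasure \<psi> (space M) > 0"
    and max: "\<And>\<phi>. irreducibility_measure M Pr \<Phi> \<phi> \<Longrightarrow> absolutely_continuous \<psi> \<phi>"
    using irr unfolding psi_irreducible_def irreducibility_measure_def by blast+
  have sp: "space \<psi> = space M" by (rule sets_eq_imp_space_eq) (rule \<psi>)
  have ne: "space M \<noteq> {}" using \<psi>(3) by auto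
  interpret sigma_finite_measure \<psi> by (rule \<psi>)
  \<comment> \<open>Since \<open>\<psi>\<close> is only sigma-finite, it is replaced by the finite
    measure with density \<open>h\<close>; strict positivity of \<open>h\<close> preserves the null
    sets.\<close>
  obtain h where h: "h \<in> borel_measurable \<psi>" "integral\<^sup>N \<psi> h \<noteq> \<infinity>"
      "\<And>x. x \<in> space M \<Longrightarrow> 0 < h x"
    using Ex_finite_integrable_function unfolding sp by blast
  note meas [simp] = measurable_cong_sets[OF \<psi>(1) refl]
  define \<phi> where "\<phi> = density \<psi> h \<bind> P"
  have kernel': "P \<in> density \<psi> h \<rightarrow>\<^sub>M subprob_algebra M" using kernel by simp
  have sets_\<phi>: "sets \<phi> = sets M"
    unfolding \<phi>_def using kernel' ne by (intro sets_bind_measurable) (auto simp: sp)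
  have \<phi>: "emeasure \<phi> B = (\<integral>\<^sup>+x. h x * trans_op (indicator B) x \<partial>\<psi>)" if B: "B \<in> sets M" for B
  proof -
    have "emeasure \<phi> B = (\<integral>\<^sup>+x. emeasure (P x) B \<partial>density \<psi> h)"
      unfolding \<phi>_def using kernel' ne B by (intro emeasure_bind) (auto simp: sp)
    also have "\<dots> = (\<integral>\<^sup>+x. trans_op (indicator B) x \<partial>density \<psi> h)"
      using B by (intro nn_integral_cong) (simp add: sp trans_op_indicator)
    also have "\<dots> = (\<integral>\<^sup>+x. h x * trans_op (indicator B) x \<partial>\<psi>)"
      using h B by (intro nn_integral_density) auto
    finally show ?thesis .
  qed
  have null_iff: "emeasure \<phi> B = 0 \<longleftrightarrow> emeasure \<psi> {x \<in> space M. trans_op (indicator B) x \<noteq> 0} = 0"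
    if B: "B \<in> sets M" for B
  proof -
    have "{x \<in> space \<psi>. h x * trans_op (indicator B) x \<noteq> 0} =
        {x \<in> space M. trans_op (indicator B) x \<noteq> 0}"
      using h(3) by (force simp: sp)
    then show ?thesis
      unfolding \<phi>[OF B] using h(1) B by (subst nn_integral_0_iff) auto
  qed
  have hits: "\<exists>n\<ge>1. nstep Pr \<Phi> n x B > 0"
    if B: "B \<in> sets M" "emeasure \<phi> B > 0" and x: "x \<in> space M" for B x
  proof -
    \<comment> \<open>The points from which one step leads into \<open>B\<close> with positive
      probability. This set has positive \<open>\<psi>\<close>-measure, so it is reached from
      \<open>x\<close>, and one further step reaches \<open>B\<close>.\<close>
    let ?B' = "{x \<in> space M. trans_op (indicator B) x \<noteq> 0}"
    note [measurable] = B(1)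
    have "?B' \<in> sets M" by measurable
    moreover have "emeasure \<psi> ?B' > 0" using null_iff[OF B(1)] B(2) by (simp add: zero_less_iff_neq_zero)
    ultimately obtain n where n: "(trans_op ^^ Suc n) (indicator ?B') x > 0"
      using irreducible_hits[OF irr _ _ x] by blast
    have "(trans_op ^^ Suc n) (indicator ?B') x \<le>
        (trans_op ^^ Suc n) (\<lambda>y. top * trans_op (indicator B) y) x"
      using x by (intro trans_pow_mono) (auto simp: indicator_def ennreal_top_mult)
    also have "\<dots> = top * (trans_op ^^ Suc n) (trans_op (indicator B)) x"
      using x by (intro trans_pow_cmult) auto
    also have "(trans_op ^^ Suc n) (trans_op (indicator B)) x = nstep Pr \<Phi> (Suc (Suc n)) x B"
      using x by (simp add: nstep_Suc funpow_swap1)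
    finally have "nstep Pr \<Phi> (Suc (Suc n)) x B \<noteq> 0" using n by auto
    then show ?thesis by (intro exI[of _ "Suc (Suc n)"]) (simp add: zero_less_iff_neq_zero)
  qed
  \<comment> \<open>Otherwise the chain would leave almost surely in one step from some
    \<open>x\<close>; it could then not be in \<open>space M\<close> at any later time, against
    irreducibility.\<close>
  have "emeasure \<phi> (space M) > 0"
  proof (rule ccontr)
    assume "\<not> emeasure \<phi> (space M) > 0"
    then have "emeasure \<psi> {x \<in> space M. trans_op (indicator (space M)) x \<noteq> 0} = 0"
      using null_iff[of "space M"] by simp
    then have "{x \<in> space M. trans_op (indicator (space M)) x \<noteq> 0} \<noteq> space M"
      using \<psi>(3) by auto
    then obtain x where x: "x \<in> space M" "trans_op (indicator (space M)) x = 0" by blast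
    have "(trans_op ^^ Suc n) (indicator (space M)) x = 0" for n
    proof -
      have "(trans_op ^^ n) (indicator (space M)) y \<le> indicator (space M) y" if "y \<in> space M" for y
        using that by (intro trans_pow_le_superharmonic) (auto intro: trans_op_le_const)
      then have "(trans_op ^^ Suc n) (indicator (space M)) x \<le> trans_op (indicator (space M)) x"
        using x(1) by (auto intro: trans_op_mono)
      then show ?thesis using x(2) by simp
    qed
    then show False using irreducible_hits[OF irr sets.top \<psi>(3) x(1)] by auto
  qed
  moreover have "sigma_finite_measure \<phi>"
  proof -
    have "emeasure \<phi> (space \<phi>) = (\<integral>\<^sup>+x. h x * trans_op (indicator (space M)) x \<partial>\<psi>)"
      using sets_eq_imp_space_eq[OF sets_\<phi>] by (simp add: \<phi>)
    also have "\<dots> \<le> (\<integral>\<^sup>+x. h x * 1 \<partial>\<psi>)"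
      by (intro nn_integral_mono mult_left_mono trans_op_le_const) (auto simp: sp indicator_def)
    finally have "emeasure \<phi> (space \<phi>) \<noteq> \<infinity>" using h(2) by (auto simp: top_unique)
    then interpret finite_measure \<phi> by (rule finite_measureI)
    show ?thesis by unfold_locales
  qed
  ultimately have "irreducibility_measure M Pr \<Phi> \<phi>"
    unfolding irreducibility_measure_def using sets_\<phi> hits by blast
  then have "absolutely_continuous \<psi> \<phi>" by (rule max)
  then have "emeasure \<phi> N = 0"
    using N unfolding absolutely_continuous_def by (auto simp: null_sets_def \<psi>(1))
  then show ?thesis using null_iff N by simp
qed

text \<open>From almost every point \<open>N\<close> is never visited, time 0 included. The support
  of the next power lies in the set from which one step leads into the support \<open>S n\<close> of
  the current one, so nullity propagates by induction.\<close>

lemma null_set_potential: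
  assumes irr: "psi_irreducible M Pr \<Phi> \<psi>" and N: "N \<in> sets M" "emeasure \<psi> N = 0"
  shows "emeasure \<psi> {x \<in> space M. (\<Sum>n. (trans_op ^^ n) (indicator N) x) \<noteq> 0} = 0"
proof -
  have sets: "sets \<psi> = sets M"
    using irr unfolding psi_irreducible_def irreducibility_measure_def by blast
  define f where "f n = (trans_op ^^ n) (indicator N :: 'a \<Rightarrow> ennreal)" for n
  have f_meas: "f n \<in> borel_measurable M" for n
    unfolding f_def using N(1) by (intro trans_pow_measurable borel_measurable_indicator)
  define S where "S n = {x \<in> space M. f n x \<noteq> 0}" for n
  have S_sets: "S n \<in> sets M" for n
    unfolding S_def using f_meas[of n] by measurable
  have "emeasure \<psi> (S n) = 0" for n
  proof (induction n)
    case 0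
    have "S 0 = N"
      unfolding S_def f_def using sets.sets_into_space[OF N(1)] by (auto simp: indicator_def)
    then show ?case using N(2) by simp
  next
    case (Suc n)
    let ?T = "{x \<in> space M. trans_op (indicator (S n)) x \<noteq> 0}"
    have "S (Suc n) \<subseteq> ?T"
    proof
      fix x assume "x \<in> S (Suc n)"
      then have x: "x \<in> space M" "f (Suc n) x \<noteq> 0" by (simp_all add: S_def)
      have "f (Suc n) x = trans_op (f n) x" by (simp add: f_def)
      also have "\<dots> \<le> trans_op (\<lambda>y. top * indicator (S n) y) x"
        unfolding S_def using x(1) by (intro trans_op_mono le_top_indicator_support)
      also have "\<dots> = top * trans_op (indicator (S n)) x"
        using x(1) S_sets by (intro trans_op_cmult borel_measurable_indicator)
      finally show "x \<in> ?T" using x by (intro CollectI conjI notI) simp_all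
    qed
    moreover have "emeasure \<psi> ?T = 0"
      by (rule null_set_trans_op[OF irr S_sets Suc])
    moreover have "?T \<in> sets \<psi>"
    proof -
      have [measurable]: "S n \<in> sets M" by (rule S_sets)
      show ?thesis unfolding sets by measurable
    qed
    ultimately show ?case using emeasure_eq_0 by blast
  qed
  then have "(\<Union>n. S n) \<in> null_sets \<psi>"
    using S_sets by (intro null_sets_UN) (simp add: null_sets_def sets)
  also have "(\<Union>n. S n) = {x \<in> space M. (\<Sum>n. f n x) \<noteq> 0}"
    by (auto simp: S_def suminf_eq_zero_iff[OF summableI])
  finally show ?thesis unfolding f_def by auto
qed

section \<open>The implications\<close>

text \<open>If the points of \<open>A\<close> with return probability below 1 formed a null set,
  then deleting all points that can reach them would leave a point of \<open>A\<close> with infinite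
  occupation. Hence they have positive measure, and so does one of countably many level
  sets.\<close>

lemma small_return_probability_set:
  assumes irr: "psi_irreducible M Pr \<Phi> \<psi>" and A: "A \<in> pos_sets M \<psi>"
    and fin: "\<And>x. x \<in> A \<Longrightarrow> occupation A x < \<infinity>"
  shows "\<exists>B\<in>pos_sets M \<psi>. \<exists>c<1. B \<subseteq> A \<and> (\<forall>x\<in>B. return_prob Pr \<Phi> x A \<le> c)"
proof -
  have [measurable]: "A \<in> sets M" and posA: "emeasure \<psi> A > 0" using A by (auto simp: pos_sets_def)
  have sets: "sets \<psi> = sets M"
    using irr unfolding psi_irreducible_def irreducibility_measure_def by blast
  have sp: "A \<subseteq> space M" by (rule sets.sets_into_space) simp
  define L where "L x = (\<Sum>n. first_return A n x)" for x
  have [measurable]: "L \<in> borel_measurable M" unfolding L_def by measurable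
  define A' where "A' = {x \<in> space M. x \<in> A \<and> L x < 1}"
  have [measurable]: "A' \<in> sets M" unfolding A'_def by measurable
  \<comment> \<open>The levels \<open>1 - 1 / Suc i\<close> are below 1 and increase to 1, so these
    sets exhaust \<open>A'\<close>.\<close>
  define B where "B i = {x \<in> space M. x \<in> A \<and> L x \<le> ennreal (1 - 1 / Suc i)}" for i :: nat
  have [measurable]: "B i \<in> sets M" for i unfolding B_def by measurable
  have "emeasure \<psi> A' > 0"
  proof (rule ccontr)
    assume "\<not> emeasure \<psi> A' > 0"
    define R where "R x = (\<Sum>n. (trans_op ^^ n) (indicator A') x)" for x
    have [measurable]: "R \<in> borel_measurable M" unfolding R_def by measurable
    \<comment> \<open>The potential \<open>R\<close> includes time 0, so \<open>Z\<close> contains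
      \<open>A'\<close>. It is null, and since \<open>R\<close> is superharmonic it cannot be
      entered from outside.\<close>
    define Z where "Z = {x \<in> space M. R x \<noteq> 0}"
    have [measurable]: "Z \<in> sets M" unfolding Z_def by measurable
    have Z: "emeasure \<psi> Z = 0"
      unfolding Z_def R_def using \<open>\<not> emeasure \<psi> A' > 0\<close> by (intro null_set_potential irr) auto
    have R: "trans_op R x \<le> R x" if "x \<in> space M" for x
    proof -
      have "trans_op R x = (\<Sum>n. (trans_op ^^ Suc n) (indicator A') x)"
        unfolding R_def using that by (subst trans_op_suminf) auto
      also have "\<dots> \<le> indicator A' x + \<dots>" by simp
      also have "\<dots> = R x" unfolding R_def by (subst (2) ennreal_suminf_split_head) simp
      finally show ?thesis .
    qed
    have "A - Z \<noteq> {}"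
    proof
      assume "A - Z = {}"
      then have "emeasure \<psi> A \<le> emeasure \<psi> Z" by (intro emeasure_mono) (auto simp: sets)
      then show False using Z posA by simp
    qed
    then obtain x where x: "x \<in> A - Z" by blast
    have "occupation A x = top"
    proof (rule occupation_eq_top[OF _ _ _ _ x])
      fix y assume y: "y \<in> A - Z"
      then have R0: "y \<in> space M" "R y = 0" using sp by (auto simp: Z_def)
      show "(trans_op ^^ Suc n) (indicator Z) y = 0" for n
        unfolding Z_def using R0 by (intro trans_pow_superharmonic_zero R) auto
      have "indicator A' y \<le> R y"
        unfolding R_def by (subst ennreal_suminf_split_head) simp
      then have "y \<notin> A'" using R0(2) by (simp add: indicator_def split: if_splits)
      then show "1 \<le> (\<Sum>n. first_return A n y)"
        using y R0(1) unfolding A'_def L_def by auto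
    qed auto
    then show False using fin[of x] x by simp
  qed
  moreover have "A' \<subseteq> (\<Union>i. B i)"
  proof
    fix x assume x: "x \<in> A'"
    then obtain r where r: "L x = ennreal r" "0 \<le> r" "r < 1"
      unfolding A'_def by (cases "L x") auto
    obtain i where "inverse (real (Suc i)) < 1 - r"
      using reals_Archimedean[of "1 - r"] r by auto
    then have "x \<in> B i"
      using x r unfolding A'_def B_def by (auto intro!: ennreal_leI simp: inverse_eq_divide)
    then show "x \<in> (\<Union>i. B i)" by blast
  qed
  ultimately have "emeasure \<psi> (\<Union>i. B i) \<noteq> 0"
    using emeasure_mono[of A' "\<Union>i. B i" \<psi>] by (auto simp: sets)
  moreover have "range B \<subseteq> sets \<psi>" unfolding sets using \<open>\<And>i. B i \<in> sets M\<close> by blast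
  ultimately obtain i where i: "emeasure \<psi> (B i) \<noteq> 0"
    using emeasure_UN_eq_0[of \<psi> B] by blast
  show ?thesis
  proof (intro bexI[of _ "B i"] exI[of _ "ennreal (1 - 1 / Suc i)"] conjI ballI)
    show "B i \<in> pos_sets M \<psi>" using i by (simp add: pos_sets_def zero_less_iff_neq_zero)
    show "return_prob Pr \<Phi> x A \<le> ennreal (1 - 1 / Suc i)" if "x \<in> B i" for x
      using that by (auto simp: B_def return_prob_eq L_def)
  qed (auto simp: B_def ennreal_less_one_iff)
qed

text \<open>The witness is a subset \<open>B\<close> of \<open>A\<close> with uniformly small
  probability of return to \<open>A\<close>. Shrinking the target only lowers return probabilities,
  and a first return to \<open>B\<close> at time \<open>n + 1\<close> is in particular a visit to
  \<open>A\<close> then.\<close>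

lemma transient_set_imp_return_moment:
  assumes irr: "psi_irreducible M Pr \<Phi> \<psi>" and A: "A \<in> pos_sets M \<psi>"
    and fin: "(SUP x\<in>A. \<Sum>n. of_nat (Suc n) ^ l * nstep Pr \<Phi> (Suc n) x A) < \<infinity>"
  shows "\<exists>A\<in>pos_sets M \<psi>.
    (SUP x\<in>A. return_prob Pr \<Phi> x A) < 1 \<and> (SUP x\<in>A. return_moment Pr \<Phi> l x A) < \<infinity>"
proof -
  have [measurable]: "A \<in> sets M" using A by (auto simp: pos_sets_def)
  have sp: "A \<subseteq> space M" by (rule sets.sets_into_space) simp
  let ?S = "SUP x\<in>A. \<Sum>n. of_nat (Suc n) ^ l * nstep Pr \<Phi> (Suc n) x A"
  have S: "(\<Sum>n. of_nat (Suc n) ^ l * (trans_op ^^ Suc n) (indicator A) x) \<le> ?S" if "x \<in> A" for x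
  proof -
    have "(\<Sum>n. of_nat (Suc n) ^ l * nstep Pr \<Phi> (Suc n) x A) \<le> ?S" using that by (rule SUP_upper)
    then show ?thesis using that sp by (auto simp: nstep_Suc simp del: funpow.simps of_nat_Suc)
  qed
  have "occupation A x < \<infinity>" if "x \<in> A" for x
  proof -
    have "1 * (trans_op ^^ Suc n) (indicator A) x \<le> of_nat (Suc n) ^ l * (trans_op ^^ Suc n) (indicator A) x" for n
      by (intro mult_right_mono one_le_power) (simp_all del: of_nat_Suc add: of_nat_Suc[symmetric])
    then have "occupation A x \<le> (\<Sum>n. of_nat (Suc n) ^ l * (trans_op ^^ Suc n) (indicator A) x)"
      unfolding occupation_def by (intro suminf_le summableI) simp
    also have "\<dots> \<le> ?S" using that by (rule S)
    finally show ?thesis using fin by (rule order.strict_trans1)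
  qed
  then obtain B c where B: "B \<in> pos_sets M \<psi>" "c < 1" "B \<subseteq> A"
      "\<And>x. x \<in> B \<Longrightarrow> return_prob Pr \<Phi> x A \<le> c"
    using small_return_probability_set[OF irr A] by blast
  have [measurable]: "B \<in> sets M" using B by (auto simp: pos_sets_def)
  have "(SUP x\<in>B. return_prob Pr \<Phi> x B) \<le> c"
  proof (rule SUP_least)
    fix x assume x: "x \<in> B"
    then have "return_prob Pr \<Phi> x B \<le> return_prob Pr \<Phi> x A"
      using B(3) sp by (intro return_prob_mono) auto
    then show "return_prob Pr \<Phi> x B \<le> c" using B(4)[OF x] by (rule order_trans)
  qed
  moreover have "(SUP x\<in>B. return_moment Pr \<Phi> l x B) \<le> ?S"
  proof (rule SUP_least)
    fix x assume x: "x \<in> B"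
    then have xM: "x \<in> space M" "x \<in> A" using B(3) sp by auto
    have "first_return B n x \<le> (trans_op ^^ Suc n) (indicator A) x" for n
    proof -
      have "first_return B n x \<le> (trans_op ^^ Suc n) (indicator B) x"
        using xM by (intro first_return_le)
      also have "\<dots> \<le> (trans_op ^^ Suc n) (indicator A) x"
        using xM B(3) by (intro trans_pow_mono) (auto simp: indicator_def)
      finally show ?thesis .
    qed
    then have "return_moment Pr \<Phi> l x B \<le> (\<Sum>n. of_nat (Suc n) ^ l * (trans_op ^^ Suc n) (indicator A) x)"
      unfolding return_moment_eq[OF xM(1) \<open>B \<in> sets M\<close>]
      by (intro suminf_le summableI mult_left_mono) auto
    also have "\<dots> \<le> ?S" using xM by (intro S)
    finally show "return_moment Pr \<Phi> l x B \<le> ?S" .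
  qed
  ultimately show ?thesis using B(1,2) fin by (meson order.strict_trans1)
qed

text \<open>The functions are the hitting moments in reverse order. Off \<open>A\<close> the drift
  relation is an equality; on \<open>A\<close> the average of the last one is the return
  probability, and that of the first is at most \<open>fact l\<close> times the return
  moment.\<close>

lemma return_moment_imp_drift:
  assumes A: "A \<in> pos_sets M \<psi>" and ne: "A \<noteq> {}"
    and L: "(SUP x\<in>A. return_prob Pr \<Phi> x A) < 1"
    and E: "(SUP x\<in>A. return_moment Pr \<Phi> l x A) < \<infinity>"
  shows "\<exists>(d::real) (b::real) (W :: nat \<Rightarrow> 'a \<Rightarrow> ennreal).
      0 < d \<and> 0 < b \<and> b < 1 \<and>
      (\<forall>i\<le>l. W i \<in> borel_measurable M) \<and> W (Suc l) = (\<lambda>x. 0) \<and>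
      (\<exists>x0\<in>space M. \<forall>i\<le>l. W i x0 < \<infinity>) \<and>
      (\<forall>i\<le>l. \<forall>x\<in>space M - A.
         (\<integral>\<^sup>+y. W i y \<partial>P x) + of_nat (l - i) * W (Suc i) x \<le> W i x) \<and>
      (\<forall>i\<le>l. \<forall>x\<in>A. 1 \<le> W i x) \<and>
      (\<forall>x\<in>A. (\<integral>\<^sup>+y. W 0 y \<partial>P x) \<le> ennreal d) \<and>
      (\<forall>x\<in>A. (\<integral>\<^sup>+y. W l y \<partial>P x) \<le> ennreal b)"
proof -
  have [measurable]: "A \<in> sets M" using A by (auto simp: pos_sets_def)
  have sp: "A \<subseteq> space M" by (rule sets.sets_into_space) simp
  define W where "W i = (if i \<le> l then hit_moment A (l - i) else (\<lambda>x. 0))" for i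
  let ?L = "SUP x\<in>A. return_prob Pr \<Phi> x A" and ?E = "SUP x\<in>A. return_moment Pr \<Phi> l x A"
  obtain c where c: "?L = ennreal c" "0 \<le> c" "c < 1" using L by (cases ?L) auto
  obtain e where e: "?E = ennreal e" "0 \<le> e" using E by (cases ?E) auto
  \<comment> \<open>The bound \<open>c\<close> may be 0, whereas \<open>b\<close> must be positive;
    the summand 1 in \<open>d\<close> serves the same purpose.\<close>
  define b where "b = max c (1/2)"
  define d where "d = fact l * e + 1"
  have QWl: "trans_op (W l) x \<le> ennreal b" if "x \<in> A" for x
  proof -
    have "trans_op (W l) x = return_prob Pr \<Phi> x A"
      using that sp by (auto simp: W_def trans_op_hit_moment return_prob_eq)
    also have "\<dots> \<le> ?L" using that by (rule SUP_upper)
    also have "\<dots> \<le> ennreal b" unfolding c b_def by (intro ennreal_leI) simp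
    finally show ?thesis .
  qed
  have QW0: "trans_op (W 0) x \<le> ennreal d" if "x \<in> A" for x
  proof -
    have "trans_op (W 0) x = (\<Sum>n. of_nat (fact l * ((n + l) choose l)) * first_return A n x)"
      using that sp by (auto simp: W_def trans_op_hit_moment)
    also have "\<dots> \<le> (\<Sum>n. of_nat (fact l * Suc n ^ l) * first_return A n x)"
      by (intro suminf_le summableI mult_right_mono of_nat_mono mult_left_mono binomial_le_power) auto
    also have "\<dots> = of_nat (fact l) * return_moment Pr \<Phi> l x A"
      using that sp
      by (subst return_moment_eq)
        (auto simp: mult.assoc simp del: of_nat_Suc of_nat_fact simp flip: ennreal_suminf_cmult)
    also have "\<dots> \<le> of_nat (fact l) * ennreal e"
      using that unfolding e(1)[symmetric] by (intro mult_left_mono SUP_upper) auto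
    also have "\<dots> = ennreal (fact l * e)"
      using e by (simp add: ennreal_mult ennreal_of_nat_eq_real_of_nat[of "fact l"] del: of_nat_fact) simp
    also have "\<dots> \<le> ennreal d" unfolding d_def by (intro ennreal_leI) simp
    finally show ?thesis .
  qed
  have drift: "trans_op (W i) x + of_nat (l - i) * W (Suc i) x \<le> W i x"
    if "i \<le> l" "x \<in> space M - A" for i x
  proof (cases "i = l")
    case True
    then show ?thesis using that by (simp add: W_def hit_moment_0_drift)
  next
    case False
    then have "l - i = Suc (l - Suc i)" "i \<le> l" "Suc i \<le> l" using that by auto
    then show ?thesis using hit_moment_drift[of A x "l - Suc i"] that by (simp add: W_def)
  qed
  obtain x0 where x0: "x0 \<in> A" using ne by blast
  show ?thesis
  proof (rule exI[of _ d], rule exI[of _ b], rule exI[of _ W],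
      intro conjI allI impI ballI bexI[of _ x0])
    show "0 < d" "0 < b" "b < 1" using c e by (auto simp: d_def b_def add_nonneg_pos)
    show "W i \<in> borel_measurable M" if "i \<le> l" for i unfolding W_def by simp
    show "W (Suc l) = (\<lambda>x. 0)" by (simp add: W_def)
    show "W i x0 < \<infinity>" if "i \<le> l" for i
      using that x0 hit_moment_in[OF x0, of "l - i"] of_nat_less_top[of "fact (l - i)"]
      by (simp add: W_def)
    show "1 \<le> W i x" if "i \<le> l" "x \<in> A" for i x
      using that of_nat_mono[OF fact_ge_1, of "l - i", where 'a = ennreal]
      by (simp add: W_def hit_moment_in)
    show "x0 \<in> space M" using x0 sp by auto
    show "(\<integral>\<^sup>+y. W i y \<partial>P x) + of_nat (l - i) * W (Suc i) x \<le> W i x"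
      if "i \<le> l" "x \<in> space M - A" for i x
      using drift[OF that] unfolding trans_op_def .
    show "(\<integral>\<^sup>+y. W 0 y \<partial>P x) \<le> ennreal d" "(\<integral>\<^sup>+y. W l y \<partial>P x) \<le> ennreal b" if "x \<in> A" for x
      using QW0[OF that] QWl[OF that] unfolding trans_op_def .
  qed
qed

text \<open>Lowering the drift functions to 1 on \<open>A\<close> decreases their averages and
  leaves their values off \<open>A\<close> unchanged, so all inequalities survive and the iterated
  potential bound applies.\<close>

lemma drift_imp_transient_set:
  fixes d b :: real
  assumes A: "A \<in> sets M" and bd: "0 < b" "b < 1" "0 < d"
    and W: "\<And>i. i \<le> l \<Longrightarrow> W i \<in> borel_measurable M"
    and drift: "\<And>i x. i \<le> l \<Longrightarrow> x \<in> space M - A \<Longrightarrow>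
      (\<integral>\<^sup>+y. W i y \<partial>P x) + of_nat (l - i) * W (Suc i) x \<le> W i x"
    and ge1: "\<And>i x. i \<le> l \<Longrightarrow> x \<in> A \<Longrightarrow> 1 \<le> W i x"
    and d: "\<And>x. x \<in> A \<Longrightarrow> (\<integral>\<^sup>+y. W 0 y \<partial>P x) \<le> ennreal d"
    and b: "\<And>x. x \<in> A \<Longrightarrow> (\<integral>\<^sup>+y. W l y \<partial>P x) \<le> ennreal b"
  shows "(SUP x\<in>A. \<Sum>n. of_nat (Suc n) ^ l * nstep Pr \<Phi> (Suc n) x A) < \<infinity>"
proof -
  note [measurable] = A
  have sp: "A \<subseteq> space M" by (rule sets.sets_into_space) simp
  \<comment> \<open>The order is reversed, so that the iteration starts at \<open>W l\<close>, whose
    average on \<open>A\<close> is at most \<open>b < 1\<close>.\<close>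
  define w where "w j x = (if x \<in> A then 1 else W (l - j) x)" for j x
  have w_le: "w j x \<le> W (l - j) x" for j x using ge1 by (auto simp: w_def)
  have w_trans: "trans_op (w j) x \<le> trans_op (W (l - j)) x" if "x \<in> space M" for j x
    using that by (intro trans_op_mono w_le)
  have "\<exists>C::real. \<forall>x\<in>space M. \<forall>N.
      (\<Sum>n<N. of_nat ((n + l) choose l) * (trans_op ^^ n) (indicator A) x) \<le> ennreal C * w l x"
  proof (rule iterated_potential_bound[where b = b and d = d and l = l])
    show "w j \<in> borel_measurable M" for j
      using W[of "l - j"] unfolding w_def by measurable
    show "trans_op (w 0) x \<le> w 0 x" if "x \<in> space M - A" for x
      using w_trans[of x 0] drift[of l x] that by (auto simp: w_def trans_op_def intro: order_trans)
    show "w j x + trans_op (w (Suc j)) x \<le> w (Suc j) x" if j: "j < l" and x: "x \<in> space M - A" for j x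
    proof -
      have l: "l - (l - Suc j) = Suc j" "Suc (l - Suc j) = l - j" "l - Suc j \<le> l" using j by auto
      \<comment> \<open>The drift coefficient is at least 1 and the iteration needs only a
        coefficient 1.\<close>
      have "w j x \<le> of_nat (Suc j) * W (l - j) x"
        using x mult_right_mono[of 1 "of_nat (Suc j)" "W (l - j) x"] by (simp add: w_def)
      then have "w j x + trans_op (w (Suc j)) x \<le>
          trans_op (W (l - Suc j)) x + of_nat (Suc j) * W (l - j) x"
        using w_trans[of x "Suc j"] x by (subst add.commute) (auto intro: add_mono)
      also have "\<dots> \<le> W (l - Suc j) x"
        using drift[OF l(3) x] unfolding l trans_op_def .
      finally show ?thesis using x by (simp add: w_def)
    qed
    show "trans_op (w 0) x \<le> ennreal b" "trans_op (w l) x \<le> ennreal d" if "x \<in> A" for x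
      using w_trans[of x 0] w_trans[of x l] b[OF that] d[OF that] that sp
      by (auto simp: trans_op_def intro: order_trans)
  qed (use bd in \<open>auto simp: w_def\<close>)
  then obtain C :: real where C: "\<And>x N. x \<in> A \<Longrightarrow>
      (\<Sum>n<N. of_nat ((n + l) choose l) * (trans_op ^^ n) (indicator A) x) \<le> ennreal C"
    using sp by (fastforce simp: w_def)
  have "(SUP x\<in>A. \<Sum>n. of_nat (Suc n) ^ l * nstep Pr \<Phi> (Suc n) x A) \<le> of_nat (fact l) * ennreal C"
  proof (rule SUP_least)
    fix x assume x: "x \<in> A"
    let ?v = "\<lambda>n. of_nat ((n + l) choose l) * (trans_op ^^ n) (indicator A) x"
    have "of_nat (Suc n) ^ l * nstep Pr \<Phi> (Suc n) x A \<le> of_nat (fact l) * ?v (Suc n)" for n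
    proof -
      have "(of_nat (Suc n ^ l) :: ennreal) \<le> of_nat (fact l * ((Suc n + l) choose l))"
        by (intro of_nat_mono power_le_fact_binomial)
      then have "of_nat (Suc n ^ l) * (trans_op ^^ Suc n) (indicator A) x \<le>
          of_nat (fact l * ((Suc n + l) choose l)) * (trans_op ^^ Suc n) (indicator A) x"
        by (rule mult_right_mono) simp
      then show ?thesis
        using x sp by (subst nstep_Suc) (auto simp only: of_nat_power of_nat_mult mult.assoc A)
    qed
    then have "(\<Sum>n. of_nat (Suc n) ^ l * nstep Pr \<Phi> (Suc n) x A) \<le> (\<Sum>n. of_nat (fact l) * ?v (Suc n))"
      by (intro suminf_le summableI)
    also have "\<dots> = of_nat (fact l) * (\<Sum>n. ?v (Suc n))" by (rule ennreal_suminf_cmult)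
    also have "(\<Sum>n. ?v (Suc n)) \<le> (\<Sum>n. ?v n)"
      by (subst (2) ennreal_suminf_split_head) simp
    also have "(\<Sum>n. ?v n) \<le> ennreal C" using C[OF x] by (intro suminf_le_const summableI)
    finally show "(\<Sum>n. of_nat (Suc n) ^ l * nstep Pr \<Phi> (Suc n) x A) \<le> of_nat (fact l) * ennreal C"
      by (simp add: mult_left_mono)
  qed
  also have "\<dots> < \<infinity>" using of_nat_less_top[of "fact l"] by (auto simp: ennreal_mult_less_top)
  finally show ?thesis .
qed

lemma transient_set_imp_transient_chain:
  assumes irr: "psi_irreducible M Pr \<Phi> \<psi>" and A: "A \<in> pos_sets M \<psi>"
    and fin: "(SUP x\<in>A. \<Sum>n. of_nat (Suc n) ^ l * nstep Pr \<Phi> (Suc n) x A) < \<infinity>"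
  shows "transient_chain M Pr \<Phi> \<psi> l"
proof -
  have [measurable]: "A \<in> sets M" and posA: "emeasure \<psi> A > 0" using A by (auto simp: pos_sets_def)
  have sp: "A \<subseteq> space M" by (rule sets.sets_into_space) simp
  have sets: "sets \<psi> = sets M" and pos: "emeasure \<psi> (space M) > 0"
    using irr unfolding psi_irreducible_def irreducibility_measure_def by blast+
  define V where "V x = (\<Sum>n. of_nat (Suc n) ^ l * (trans_op ^^ Suc n) (indicator A) x)" for x
  have [measurable]: "V \<in> borel_measurable M" unfolding V_def by measurable
  have V_fin: "V x < \<infinity>" if "x \<in> A" for x
  proof -
    have "V x = (\<Sum>n. of_nat (Suc n) ^ l * nstep Pr \<Phi> (Suc n) x A)"
      unfolding V_def using that sp by (intro suminf_cong, subst nstep_Suc) auto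
    also have "\<dots> \<le> (SUP x\<in>A. \<Sum>n. of_nat (Suc n) ^ l * nstep Pr \<Phi> (Suc n) x A)"
      using that by (rule SUP_upper)
    finally show ?thesis using fin by (rule order.strict_trans1)
  qed
  have V: "trans_op V x \<le> V x" if x: "x \<in> space M" for x
  proof -
    have "trans_op V x = (\<Sum>n. trans_op (\<lambda>y. of_nat (Suc n) ^ l * (trans_op ^^ Suc n) (indicator A) y) x)"
      unfolding V_def using x by (intro trans_op_suminf) measurable
    also have "\<dots> = (\<Sum>n. of_nat (Suc n) ^ l * (trans_op ^^ Suc (Suc n)) (indicator A) x)"
      using x by (intro suminf_cong, subst trans_op_cmult) auto
    \<comment> \<open>Shifting time by one increases the weights, which makes \<open>V\<close>
      superharmonic.\<close>
    also have "\<dots> \<le> (\<Sum>n. of_nat (Suc (Suc n)) ^ l * (trans_op ^^ Suc (Suc n)) (indicator A) x)"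
      by (intro suminf_le summableI mult_right_mono power_mono of_nat_mono) auto
    also have "\<dots> \<le> V x" unfolding V_def by (subst (2) ennreal_suminf_split_head) simp
    finally show ?thesis .
  qed
  define D where "D = {x \<in> space M. V x = top}"
  have [measurable]: "D \<in> sets M" unfolding D_def by measurable
  have D: "emeasure \<psi> D = 0"
  proof (rule ccontr)
    assume "emeasure \<psi> D \<noteq> 0"
    moreover obtain x where x: "x \<in> A" using posA by fastforce
    ultimately obtain n where n: "(trans_op ^^ Suc n) (indicator D) x > 0"
      using irreducible_hits[OF irr \<open>D \<in> sets M\<close>, of x] sp by (auto simp: zero_less_iff_neq_zero)
    \<comment> \<open>As \<open>V\<close> is infinite on \<open>D\<close> and superharmonic,
      reaching \<open>D\<close> from a point of \<open>A\<close> would force \<open>V\<close> to be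
      infinite there.\<close>
    have "top * (trans_op ^^ Suc n) (indicator D) x = (trans_op ^^ Suc n) (\<lambda>y. top * indicator D y) x"
      using x sp by (intro trans_pow_cmult[symmetric]) auto
    also have "\<dots> \<le> (trans_op ^^ Suc n) V x"
      using x sp by (intro trans_pow_mono) (auto simp: indicator_def D_def)
    also have "\<dots> \<le> V x" using x sp by (intro trans_pow_le_superharmonic V) auto
    also have "\<dots> < top" using V_fin[OF x] by simp
    finally show False using n by (auto simp: ennreal_top_mult split: if_splits)
  qed
  \<comment> \<open>The index codes a pair: a level \<open>m\<close>, which bounds \<open>V\<close>
    above and visits to \<open>A\<close> below, and a time \<open>k\<close> for these
    visits.\<close>
  define B where "B i = {x \<in> space M. V x \<le> of_nat (fst (prod_decode i)) \<and>
    1 \<le> of_nat (fst (prod_decode i)) * (trans_op ^^ Suc (snd (prod_decode i))) (indicator A) x}" for i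
  have B_sets [measurable]: "B i \<in> sets M" for i unfolding B_def by measurable
  have B_transient: "uniformly_transient M Pr \<Phi> \<psi> l (B i)" if pos_B: "emeasure \<psi> (B i) > 0" for i
  proof -
    obtain m k where mk: "prod_decode i = (m, k)" by (cases "prod_decode i")
    \<comment> \<open>One factor \<open>m\<close> arises from bounding the indicator of
      \<open>B i\<close> by \<open>m\<close> times the probability of being in \<open>A\<close> at
      time \<open>k + 1\<close>, the other from \<open>V\<close> being at most \<open>m\<close> on
      \<open>B i\<close>.\<close>
    have "(SUP x\<in>B i. \<Sum>n. of_nat (Suc n) ^ l * nstep Pr \<Phi> (Suc n) x (B i)) \<le> of_nat m * of_nat m"
    proof (rule SUP_least)
      fix x assume "x \<in> B i"
      then have x: "x \<in> space M" "V x \<le> of_nat m" by (auto simp: B_def mk)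
      have "nstep Pr \<Phi> (Suc n) x (B i) \<le>
          of_nat m * (trans_op ^^ Suc k) ((trans_op ^^ Suc n) (indicator A)) x" for n
      proof -
        have "nstep Pr \<Phi> (Suc n) x (B i) \<le>
            (trans_op ^^ Suc n) (\<lambda>y. of_nat m * (trans_op ^^ Suc k) (indicator A) y) x"
          unfolding nstep_Suc[OF x(1) B_sets] using x
          by (intro trans_pow_mono) (auto simp: B_def mk indicator_def)
        also have "\<dots> = of_nat m * (trans_op ^^ Suc n) ((trans_op ^^ Suc k) (indicator A)) x"
          using x by (intro trans_pow_cmult) measurable
        \<comment> \<open>With the power \<open>Suc k\<close> outermost, the weighted sum over
          \<open>n\<close> moves inside and becomes \<open>V\<close>.\<close>
        also have "(trans_op ^^ Suc n) ((trans_op ^^ Suc k) (indicator A)) =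
            (trans_op ^^ Suc k) ((trans_op ^^ Suc n) (indicator A :: 'a \<Rightarrow> ennreal))"
          unfolding comp_apply[symmetric, of "trans_op ^^ _" "trans_op ^^ _"] funpow_add[symmetric]
          by (simp only: add.commute)
        finally show ?thesis .
      qed
      then have "(\<Sum>n. of_nat (Suc n) ^ l * nstep Pr \<Phi> (Suc n) x (B i)) \<le>
          (\<Sum>n. of_nat (Suc n) ^ l * (of_nat m * (trans_op ^^ Suc k) ((trans_op ^^ Suc n) (indicator A)) x))"
        by (intro suminf_le summableI mult_left_mono) auto
      also have "\<dots> = of_nat m * (\<Sum>n. of_nat (Suc n) ^ l * (trans_op ^^ Suc k) ((trans_op ^^ Suc n) (indicator A)) x)"
        unfolding ennreal_suminf_cmult[symmetric] by (simp only: mult_ac)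
      also have "(\<Sum>n. of_nat (Suc n) ^ l * (trans_op ^^ Suc k) ((trans_op ^^ Suc n) (indicator A)) x) =
          (\<Sum>n. (trans_op ^^ Suc k) (\<lambda>y. of_nat (Suc n) ^ l * (trans_op ^^ Suc n) (indicator A) y) x)"
        using x by (intro suminf_cong trans_pow_cmult[symmetric]) measurable
      also have "\<dots> = (trans_op ^^ Suc k) V x"
        unfolding V_def using x by (intro trans_pow_suminf[symmetric]) measurable
      also have "\<dots> \<le> V x" using x by (intro trans_pow_le_superharmonic V) auto
      also have "\<dots> \<le> of_nat m" by (rule x)
      finally show "(\<Sum>n. of_nat (Suc n) ^ l * nstep Pr \<Phi> (Suc n) x (B i)) \<le> of_nat m * of_nat m"
        by (simp add: mult_left_mono)
    qed
    also have "\<dots> < \<infinity>" by (simp add: ennreal_mult_less_top of_nat_less_top)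
    finally show ?thesis using pos_B by (simp add: uniformly_transient_def pos_sets_def)
  qed
  \<comment> \<open>Uniform transience requires positive measure, so the null sets among the
    \<open>B i\<close> join the exceptional set.\<close>
  define D' where "D' = D \<union> (\<Union>i\<in>{i. emeasure \<psi> (B i) = 0}. B i)"
  have "D' \<in> null_sets \<psi>"
    unfolding D'_def using D by (intro null_sets.Un null_sets_UN') (auto simp: null_sets_def sets)
  then have D': "D' \<in> sets M" "emeasure \<psi> D' = 0" by (auto simp: null_sets_def sets)
  have cover: "space M = D' \<union> (\<Union>i\<in>{i. emeasure \<psi> (B i) > 0}. B i)"
  proof (intro equalityI subsetI)
    fix x assume x: "x \<in> space M"
    show "x \<in> D' \<union> (\<Union>i\<in>{i. emeasure \<psi> (B i) > 0}. B i)"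
    proof (cases "V x = top")
      case False
      obtain k where k: "(trans_op ^^ Suc k) (indicator A) x > 0"
        using irreducible_hits[OF irr _ posA x] by auto
      obtain m1 where m1: "1 \<le> of_nat m1 * (trans_op ^^ Suc k) (indicator A) x"
        using ennreal_ex_nat_mult_ge_1[OF k] by blast
      obtain m2 where m2: "V x < of_nat m2"
        using ennreal_Ex_less_of_nat[of "V x"] False by (auto simp: less_top)
      have "x \<in> B (prod_encode (max m1 m2, k))"
        unfolding B_def prod_encode_inverse fst_conv snd_conv
      proof (intro CollectI conjI x)
        have "V x \<le> of_nat m2" using m2 by simp
        also have "\<dots> \<le> of_nat (max m1 m2)" by (intro of_nat_mono) simp
        finally show "V x \<le> of_nat (max m1 m2)" .
        note m1
        also have "of_nat m1 * (trans_op ^^ Suc k) (indicator A) x \<le>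
            of_nat (max m1 m2) * (trans_op ^^ Suc k) (indicator A) x"
          by (intro mult_right_mono of_nat_mono) auto
        finally show "1 \<le> of_nat (max m1 m2) * (trans_op ^^ Suc k) (indicator A) x" .
      qed
      then show ?thesis unfolding D'_def by (auto simp: zero_less_iff_neq_zero)
    qed (use x in \<open>auto simp: D'_def D_def\<close>)
  qed (use sets.sets_into_space[OF D'(1)] in \<open>auto simp: B_def\<close>)
  obtain i0 where i0: "emeasure \<psi> (B i0) > 0"
  proof (rule ccontr)
    assume "\<not> thesis"
    then have "{i. emeasure \<psi> (B i) > 0} = {}" using that by blast
    then have "space M = D'" using cover by auto
    then show False using D' pos by simp
  qed
  \<comment> \<open>A family over all indices is required; the discarded null sets are replaced by
    one fixed set of positive measure, which does not change the union.\<close>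
  define A' where "A' i = (if emeasure \<psi> (B i) > 0 then B i else B i0)" for i
  have "(\<Union>i. A' i) = (\<Union>i\<in>{i. emeasure \<psi> (B i) > 0}. B i)"
    using i0 by (auto simp: A'_def split: if_splits)
  then have "space M = D' \<union> (\<Union>i. A' i)" using cover by simp
  moreover have "uniformly_transient M Pr \<Phi> \<psi> l (A' i)" for i
    using B_transient i0 by (simp add: A'_def)
  ultimately show ?thesis unfolding transient_chain_def using irr D' by blast
qed

end

section \<open>The cycle from (1) through (2) and (3), and the equivalence of (1) and (4)\<close>

theorem theorem3p2:
  fixes M :: "'a measure" and P :: "'a \<Rightarrow> 'a measure"
    and \<Omega> :: "'w measure" and Pr :: "'a \<Rightarrow> 'w measure" and \<Phi> :: "nat \<Rightarrow> 'w \<Rightarrow> 'a option"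
    and \<psi> :: "'a measure" and l :: nat
  assumes "l \<ge> 1"
    and "countably_generated M"
    and "markov_chain M P \<Omega> Pr \<Phi>"
    and "psi_irreducible M Pr \<Phi> \<psi>"
  defines "S1 \<equiv> \<exists>A\<in>pos_sets M \<psi>.
      (SUP x\<in>A. \<Sum>n. of_nat (Suc n) ^ l * nstep Pr \<Phi> (Suc n) x A) < \<infinity>"
    and "S2 \<equiv> \<exists>A\<in>pos_sets M \<psi>.
      (SUP x\<in>A. return_prob Pr \<Phi> x A) < 1 \<and> (SUP x\<in>A. return_moment Pr \<Phi> l x A) < \<infinity>"
    and "S3 \<equiv> \<exists>A\<in>pos_sets M \<psi>. \<exists>(d::real) (b::real) (W :: nat \<Rightarrow> 'a \<Rightarrow> ennreal).
      0 < d \<and> 0 < b \<and> b < 1 \<and>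
      (\<forall>i\<le>l. W i \<in> borel_measurable M) \<and> W (Suc l) = (\<lambda>x. 0) \<and>
      (\<exists>x0\<in>space M. \<forall>i\<le>l. W i x0 < \<infinity>) \<and>
      (\<forall>i\<le>l. \<forall>x\<in>space M - A.
         (\<integral>\<^sup>+y. W i y \<partial>P x) + of_nat (l - i) * W (Suc i) x \<le> W i x) \<and>
      (\<forall>i\<le>l. \<forall>x\<in>A. 1 \<le> W i x) \<and>
      (\<forall>x\<in>A. (\<integral>\<^sup>+y. W 0 y \<partial>P x) \<le> ennreal d) \<and>
      (\<forall>x\<in>A. (\<integral>\<^sup>+y. W l y \<partial>P x) \<le> ennreal b)"
    and "S4 \<equiv> transient_chain M Pr \<Phi> \<psi> l"
  shows "(S1 \<longleftrightarrow> S2) \<and> (S2 \<longleftrightarrow> S3) \<and> (S3 \<longleftrightarrow> S4)"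
proof -
  interpret markov_chain M P \<Omega> Pr \<Phi> by fact
  note irr = \<open>psi_irreducible M Pr \<Phi> \<psi>\<close>
  have "S1 \<Longrightarrow> S2"
    unfolding S1_def S2_def by (elim bexE) (rule transient_set_imp_return_moment[OF irr])
  moreover have "S2 \<Longrightarrow> S3"
  proof -
    assume S2
    then obtain A where A: "A \<in> pos_sets M \<psi>"
      and *: "(SUP x\<in>A. return_prob Pr \<Phi> x A) < 1" "(SUP x\<in>A. return_moment Pr \<Phi> l x A) < \<infinity>"
      unfolding S2_def by blast
    have "A \<noteq> {}" using A by (auto simp: pos_sets_def)
    then show S3
      unfolding S3_def by (intro bexI[OF _ A] return_moment_imp_drift[OF A _ *])
  qed
  moreover have "S3 \<Longrightarrow> S1"
    unfolding S3_def S1_def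
  proof (elim bexE exE conjE)
    fix A and d b :: real and W :: "nat \<Rightarrow> 'a \<Rightarrow> ennreal"
    assume A: "A \<in> pos_sets M \<psi>" and *: "0 < d" "0 < b" "b < 1"
      "\<forall>i\<le>l. W i \<in> borel_measurable M"
      "\<forall>i\<le>l. \<forall>x\<in>space M - A. (\<integral>\<^sup>+y. W i y \<partial>P x) + of_nat (l - i) * W (Suc i) x \<le> W i x"
      "\<forall>i\<le>l. \<forall>x\<in>A. 1 \<le> W i x"
      "\<forall>x\<in>A. (\<integral>\<^sup>+y. W 0 y \<partial>P x) \<le> ennreal d" "\<forall>x\<in>A. (\<integral>\<^sup>+y. W l y \<partial>P x) \<le> ennreal b"
    have "A \<in> sets M" using A by (simp add: pos_sets_def)
    then have "(SUP x\<in>A. \<Sum>n. of_nat (Suc n) ^ l * nstep Pr \<Phi> (Suc n) x A) < \<infinity>"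
      by (rule drift_imp_transient_set[where b = b and d = d and W = W]) (use * in auto)
    then show "\<exists>A\<in>pos_sets M \<psi>. (SUP x\<in>A. \<Sum>n. of_nat (Suc n) ^ l * nstep Pr \<Phi> (Suc n) x A) < \<infinity>"
      using A by blast
  qed
  moreover have "S1 \<Longrightarrow> S4"
    unfolding S1_def S4_def using transient_set_imp_transient_chain[OF irr] by blast
  \<comment> \<open>Any member of the transient cover has positive measure and is itself a witness
    for (1).\<close>
  moreover have "S4 \<Longrightarrow> S1"
    unfolding S1_def S4_def transient_chain_def uniformly_transient_def by blast
  ultimately show ?thesis by blast
qed

end
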